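(* Let $(M,g)$ be an oriented Riemannian manifold of dimension $3$ and let $(X_1,X_2,X_3)$ be a global orthonormal moving frame on $M$. Then $(X_1,X_2,X_3)$ determines a top on $(M,g)$ if and only if there are real numbers $c$ and $k$ such that $$[X_1,X_2]=c\,X_3,\qquad [X_2,X_3]=k\,X_1,\qquad [X_3,X_1]=k\,X_2 .$$
   Context: All objects are smooth. Rotation speed: on an oriented Riemannian $3$-manifold $(M,g)$ with Levi-Civita connection $\nabla$ and cross product $\times$, for unit vector fields $Y,Z$ (defined at least along the curve) and a curve $\gamma$, the rotation speed of $Y$ about $Z$ along $\gamma$ with respect to the parallel transport is $R_\gamma(Y,Z)=g(\nabla_{\dot\gamma}Y, Z\times Y)$. Indexed pencil bundle: given two 1-forms $\omega_1,\omega_2$ on $M$ that are linearly independent at every point, put $\omega^\theta=\cos\theta\,\omega_1+\sin\theta\,\omega_2$. The family of plane bundles $\xi_\theta=\ker\omega^\theta$, indexed by $\theta \bmod \pi\in\mathbb{P}^1(\mathbb{R})$, is the indexed pencil bundle defined by the circle of 1-forms $\{\omega^\theta\}$; its axis bundle is the line bundle $\bigcap_\theta\xi_\theta=\ker\omega_1\cap\ker\omega_2$. A moving frame $(X_1,X_2,X_3)$ is adapted to the pencil bundle if $X_3$ is parallel to the axis bundle and there are forms $\eta_1,\eta_2$ in the defining circle with $\eta_1(X_2)=\eta_2(X_1)=0$ everywhere. Top: an indexed pencil bundle is a top if there is an orthonormal moving frame $(X_1,X_2,X_3)$ adapted to it such that (all geodesics being parameterized by arc length): (i) along any geodesic $\gamma$,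 the angle between $\dot\gamma$ and $X_3$ is constant; (ii) along any geodesic $\gamma$ transverse to the axis bundle, the rotation speed $R_\gamma(X_3,\dot\gamma)$ is constant; (iii) along any geodesic $\gamma$, the rotation speed $R_\gamma(X_1,X_3)$ is constant; (iv) for any pair of geodesics $\gamma_1,\gamma_2$ such that the angle between $\dot\gamma_1$ and $X_3$ equals the angle between $\dot\gamma_2$ and $X_3$, the rotation speed of $X_1$ about $X_3$ is the same along $\gamma_1$ and along $\gamma_2$. An orthonormal moving frame $(X_1,X_2,X_3)$ determines a top if it satisfies (i)-(iv); the underlying indexed pencil bundle is then the one defined by the 1-forms $\omega_1,\omega_2$ of the dual coframe $(\omega_1,\omega_2,\omega_3)$.
   Formalization: M is assumed connected; for disconnected M the claim fails: on the disjoint union of flat R^3 (c=k=0) and a Lie group with a left-invariant frame with c=2, k=1, conditions (i)-(iv) hold but no single c, k work. *)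

theory Defs
  imports "HOL-Analysis.Analysis"
begin

section \<open>Smoothness in Euclidean space\<close>

text \<open>Only used on open sets.\<close>

primrec k_smooth_on ::
  "nat \<Rightarrow> 'a::euclidean_space set \<Rightarrow> ('a \<Rightarrow> 'b::real_normed_vector) \<Rightarrow> bool" where
  "k_smooth_on 0 S f \<longleftrightarrow> continuous_on S f"
| "k_smooth_on (Suc k) S f \<longleftrightarrow>
     (\<forall>x\<in>S. f differentiable (at x)) \<and>
     (\<forall>v. k_smooth_on k S (\<lambda>x. frechet_derivative f (at x) v))"

definition smooth_on :: "'a::euclidean_space set \<Rightarrow> ('a \<Rightarrow> 'b::real_normed_vector) \<Rightarrow> bool" where
  "smooth_on S f \<longleftrightarrow> (\<forall>k. k_smooth_on k S f)"


section \<open>Oriented smooth 3-manifolds\<close>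

text \<open>
  The manifold is the whole type \<open>'a\<close> (which will be Hausdorff and second countable).
  A chart is a pair \<open>(U, \<phi>)\<close>; the values of \<open>\<phi>\<close> outside \<open>U\<close> are irrelevant.
\<close>

type_synonym 'a chart = "'a set \<times> ('a \<Rightarrow> real^3)"

definition is_chart :: "'a::topological_space chart \<Rightarrow> bool" where
  "is_chart c \<longleftrightarrow> (case c of (U, \<phi>) \<Rightarrow>
     open U \<and> open (\<phi> ` U) \<and> homeomorphism U (\<phi> ` U) \<phi> (inv_into U \<phi>))"

definition smooth_atlas :: "'a::topological_space chart set \<Rightarrow> bool" where
  "smooth_atlas A \<longleftrightarrow>
     (\<forall>c\<in>A. is_chart c) \<and> (\<Union>c\<in>A. fst c) = UNIV \<and>
     (\<forall>(U, \<phi>)\<in>A. \<forall>(V, \<psi>)\<in>A. smooth_on (\<phi> ` (U \<inter> V)) (\<psi> \<circ> inv_into U \<phi>))"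

text \<open>
  An orientation is given by an atlas whose transition maps have positive Jacobian determinant.
\<close>

definition oriented_smooth_atlas :: "'a::topological_space chart set \<Rightarrow> bool" where
  "oriented_smooth_atlas A \<longleftrightarrow> smooth_atlas A \<and>
     (\<forall>(U, \<phi>)\<in>A. \<forall>(V, \<psi>)\<in>A. \<forall>x\<in>\<phi> ` (U \<inter> V).
        det (matrix (frechet_derivative (\<psi> \<circ> inv_into U \<phi>) (at x))) > 0)"

definition smooth_fun ::
  "'a::topological_space chart set \<Rightarrow> 'a set \<Rightarrow> ('a \<Rightarrow> real) \<Rightarrow> bool" where
  "smooth_fun A W f \<longleftrightarrow> (\<forall>(U, \<phi>)\<in>A. smooth_on (\<phi> ` (U \<inter> W)) (f \<circ> inv_into U \<phi>))"

definition smooth_near ::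
  "'a::topological_space chart set \<Rightarrow> 'a \<Rightarrow> ('a \<Rightarrow> real) \<Rightarrow> bool" where
  "smooth_near A p f \<longleftrightarrow> (\<exists>W. open W \<and> p \<in> W \<and> smooth_fun A W f)"

definition open_interval :: "real set \<Rightarrow> bool" where
  "open_interval I \<longleftrightarrow> open I \<and> is_interval I \<and> I \<noteq> {}"

definition smooth_curve ::
  "'a::topological_space chart set \<Rightarrow> real set \<Rightarrow> (real \<Rightarrow> 'a) \<Rightarrow> bool" where
  "smooth_curve A I \<gamma> \<longleftrightarrow> open_interval I \<and> continuous_on I \<gamma> \<and>
     (\<forall>(U, \<phi>)\<in>A. smooth_on (I \<inter> \<gamma> -` U) (\<phi> \<circ> \<gamma>))"


section \<open>Tangent vectors and vector fields\<close>

text \<open>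
  A tangent vector at \<open>p\<close> is the velocity of a smooth curve through \<open>p\<close>, regarded as the operator
  \<open>f \<mapsto> (f \<circ> \<gamma>)'(0)\<close> on functions that are smooth near \<open>p\<close>.  All tangent vectors at \<open>p\<close> send the
  remaining functions to \<open>0\<close>, so that equality of tangent vectors is equality of operators; the
  linear operations are pointwise.
\<close>

type_synonym 'a tangent = "('a \<Rightarrow> real) \<Rightarrow> real"

definition velocity ::
  "'a::topological_space chart set \<Rightarrow> (real \<Rightarrow> 'a) \<Rightarrow> real \<Rightarrow> 'a tangent" where
  "velocity A \<gamma> t = (\<lambda>f. if smooth_near A (\<gamma> t) f then deriv (\<lambda>s. f (\<gamma> s)) t else 0)"

definition tangent_space :: "'a::topological_space chart set \<Rightarrow> 'a \<Rightarrow> 'a tangent set" where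
  "tangent_space A p = {velocity A \<gamma> 0 | \<gamma> I. smooth_curve A I \<gamma> \<and> 0 \<in> I \<and> \<gamma> 0 = p}"

definition smooth_vector_field ::
  "'a::topological_space chart set \<Rightarrow> 'a set \<Rightarrow> ('a \<Rightarrow> 'a tangent) \<Rightarrow> bool" where
  "smooth_vector_field A W X \<longleftrightarrow>
     (\<forall>p\<in>W. X p \<in> tangent_space A p) \<and>
     (\<forall>V f. open V \<and> V \<subseteq> W \<and> smooth_fun A V f \<longrightarrow> smooth_fun A V (\<lambda>p. X p f))"

definition lie_bracket ::
  "'a::topological_space chart set \<Rightarrow> ('a \<Rightarrow> 'a tangent) \<Rightarrow> ('a \<Rightarrow> 'a tangent)
     \<Rightarrow> 'a \<Rightarrow> 'a tangent" where
  "lie_bracket A X Y = (\<lambda>p f.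
     if smooth_near A p f then X p (\<lambda>q. Y q f) - Y p (\<lambda>q. X q f) else 0)"

definition smooth_vector_field_along ::
  "'a::topological_space chart set \<Rightarrow> real set \<Rightarrow> (real \<Rightarrow> 'a) \<Rightarrow> (real \<Rightarrow> 'a tangent) \<Rightarrow> bool" where
  "smooth_vector_field_along A I \<gamma> V \<longleftrightarrow>
     (\<forall>t\<in>I. V t \<in> tangent_space A (\<gamma> t)) \<and>
     (\<forall>W f. open W \<and> smooth_fun A W f \<longrightarrow> smooth_on (I \<inter> \<gamma> -` W) (\<lambda>t. V t f))"


section \<open>Riemannian metrics, Levi-Civita connection, covariant derivative along curves\<close>

type_synonym 'a metric = "'a \<Rightarrow> 'a tangent \<Rightarrow> 'a tangent \<Rightarrow> real"

definition riemannian_metric :: "'a::topological_space chart set \<Rightarrow> 'a metric \<Rightarrow> bool" where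
  "riemannian_metric A g \<longleftrightarrow>
     (\<forall>p. \<forall>u\<in>tangent_space A p. \<forall>v\<in>tangent_space A p. \<forall>w\<in>tangent_space A p. \<forall>a b.
        g p (\<lambda>f. a * u f + b * v f) w = a * g p u w + b * g p v w) \<and>
     (\<forall>p. \<forall>u\<in>tangent_space A p. \<forall>v\<in>tangent_space A p. g p u v = g p v u) \<and>
     (\<forall>p. \<forall>u\<in>tangent_space A p. u \<noteq> (\<lambda>f. 0) \<longrightarrow> g p u u > 0) \<and>
     (\<forall>W X Y. open W \<and> smooth_vector_field A W X \<and> smooth_vector_field A W Y \<longrightarrow>
        smooth_fun A W (\<lambda>p. g p (X p) (Y p)))"

text \<open>\<open>nabla p v Y\<close> stands for $\nabla_v Y$ with \<open>v\<close> in the tangent space at \<open>p\<close>.\<close>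

type_synonym 'a connection = "'a \<Rightarrow> 'a tangent \<Rightarrow> ('a \<Rightarrow> 'a tangent) \<Rightarrow> 'a tangent"

definition affine_connection ::
  "'a::topological_space chart set \<Rightarrow> 'a connection \<Rightarrow> bool" where
  "affine_connection A nabla \<longleftrightarrow>
     (\<forall>Y p. smooth_vector_field A UNIV Y \<longrightarrow>
        (\<forall>u\<in>tangent_space A p. \<forall>v\<in>tangent_space A p. \<forall>a b.
           nabla p (\<lambda>f. a * u f + b * v f) Y =
             (\<lambda>f. a * nabla p u Y f + b * nabla p v Y f))) \<and>
     (\<forall>Y Z p. smooth_vector_field A UNIV Y \<and> smooth_vector_field A UNIV Z \<longrightarrow>
        (\<forall>v\<in>tangent_space A p.
           nabla p v (\<lambda>q f. Y q f + Z q f) = (\<lambda>f. nabla p v Y f + nabla p v Z f))) \<and>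
     (\<forall>h Y p. smooth_fun A UNIV h \<and> smooth_vector_field A UNIV Y \<longrightarrow>
        (\<forall>v\<in>tangent_space A p.
           nabla p v (\<lambda>q f. h q * Y q f) = (\<lambda>f. v h * Y p f + h p * nabla p v Y f))) \<and>
     (\<forall>X Y. smooth_vector_field A UNIV X \<and> smooth_vector_field A UNIV Y \<longrightarrow>
        smooth_vector_field A UNIV (\<lambda>p. nabla p (X p) Y)) \<and>
     (\<forall>Y p. smooth_vector_field A UNIV Y \<longrightarrow>
        (\<forall>v\<in>tangent_space A p. nabla p v Y \<in> tangent_space A p))"

definition levi_civita ::
  "'a::topological_space chart set \<Rightarrow> 'a metric \<Rightarrow> 'a connection \<Rightarrow> bool" where
  "levi_civita A g nabla \<longleftrightarrow> affine_connection A nabla \<and>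
     (\<forall>X Y. smooth_vector_field A UNIV X \<and> smooth_vector_field A UNIV Y \<longrightarrow>
        (\<lambda>p f. nabla p (X p) Y f - nabla p (Y p) X f) = lie_bracket A X Y) \<and>
     (\<forall>Y Z p. smooth_vector_field A UNIV Y \<and> smooth_vector_field A UNIV Z \<longrightarrow>
        (\<forall>v\<in>tangent_space A p.
           v (\<lambda>q. g q (Y q) (Z q)) = g p (nabla p v Y) (Z p) + g p (Y p) (nabla p v Z)))"

text \<open>
  The covariant derivative $D/dt$ along a curve \<open>\<gamma>\<close> is the unique operator on vector fields along
  \<open>\<gamma>\<close> that is additive, satisfies the Leibniz rule, and agrees with \<open>nabla\<close> on the restrictions of
  vector fields of the manifold.  Uniqueness concerns parameters in \<open>I\<close> and smooth fields along
  \<open>\<gamma>\<close>; elsewhere the value is unspecified.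
\<close>

definition is_covariant_derivative_along ::
  "'a::topological_space chart set \<Rightarrow> 'a connection \<Rightarrow> real set \<Rightarrow> (real \<Rightarrow> 'a) \<Rightarrow>
     ((real \<Rightarrow> 'a tangent) \<Rightarrow> real \<Rightarrow> 'a tangent) \<Rightarrow> bool" where
  "is_covariant_derivative_along A nabla I \<gamma> D \<longleftrightarrow>
     (\<forall>V. smooth_vector_field_along A I \<gamma> V \<longrightarrow> smooth_vector_field_along A I \<gamma> (D V)) \<and>
     (\<forall>V W. smooth_vector_field_along A I \<gamma> V \<and> smooth_vector_field_along A I \<gamma> W \<longrightarrow>
        (\<forall>t\<in>I. D (\<lambda>s f. V s f + W s f) t = (\<lambda>f. D V t f + D W t f))) \<and>
     (\<forall>a V. smooth_on I a \<and> smooth_vector_field_along A I \<gamma> V \<longrightarrow>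
        (\<forall>t\<in>I. D (\<lambda>s f. a s * V s f) t = (\<lambda>f. deriv a t * V t f + a t * D V t f))) \<and>
     (\<forall>Y. smooth_vector_field A UNIV Y \<longrightarrow>
        (\<forall>t\<in>I. D (\<lambda>s. Y (\<gamma> s)) t = nabla (\<gamma> t) (velocity A \<gamma> t) Y))"

definition covariant_derivative_along ::
  "'a::topological_space chart set \<Rightarrow> 'a connection \<Rightarrow> real set \<Rightarrow> (real \<Rightarrow> 'a) \<Rightarrow>
     (real \<Rightarrow> 'a tangent) \<Rightarrow> real \<Rightarrow> 'a tangent" where
  "covariant_derivative_along A nabla I \<gamma> =
     (SOME D. is_covariant_derivative_along A nabla I \<gamma> D)"

definition arc_length_geodesic ::
  "'a::topological_space chart set \<Rightarrow> 'a metric \<Rightarrow> 'a connection \<Rightarrow>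
     real set \<Rightarrow> (real \<Rightarrow> 'a) \<Rightarrow> bool" where
  "arc_length_geodesic A g nabla I \<gamma> \<longleftrightarrow> smooth_curve A I \<gamma> \<and>
     (\<forall>t\<in>I. covariant_derivative_along A nabla I \<gamma> (velocity A \<gamma>) t = (\<lambda>f. 0)) \<and>
     (\<forall>t\<in>I. g (\<gamma> t) (velocity A \<gamma> t) (velocity A \<gamma> t) = 1)"


section \<open>Cross product, angle, rotation speed\<close>

definition chart_components :: "('a \<Rightarrow> real^3) \<Rightarrow> 'a tangent \<Rightarrow> real^3" where
  "chart_components \<phi> v = (\<chi> i. v (\<lambda>q. \<phi> q $ i))"

definition positive_triple ::
  "'a chart set \<Rightarrow> 'a \<Rightarrow> 'a tangent \<Rightarrow> 'a tangent \<Rightarrow> 'a tangent \<Rightarrow> bool" where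
  "positive_triple A p u v w \<longleftrightarrow> (\<exists>(U, \<phi>)\<in>A. p \<in> U \<and>
     det (vector [chart_components \<phi> u, chart_components \<phi> v, chart_components \<phi> w]
            :: real^3^3) > 0)"

text \<open>
  For linearly dependent \<open>u\<close> and \<open>v\<close> the length condition forces the cross product to vanish, hence
  the proviso on the orientation.
\<close>

definition cross_product ::
  "'a::topological_space chart set \<Rightarrow> 'a metric \<Rightarrow> 'a \<Rightarrow> 'a tangent \<Rightarrow> 'a tangent \<Rightarrow> 'a tangent" where
  "cross_product A g p u v = (THE w. w \<in> tangent_space A p \<and>
     g p w u = 0 \<and> g p w v = 0 \<and>
     g p w w = g p u u * g p v v - (g p u v)\<^sup>2 \<and>
     (w \<noteq> (\<lambda>f. 0) \<longrightarrow> positive_triple A p u v w))"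

definition angle :: "'a metric \<Rightarrow> 'a \<Rightarrow> 'a tangent \<Rightarrow> 'a tangent \<Rightarrow> real" where
  "angle g p u v = arccos (g p u v / (sqrt (g p u u) * sqrt (g p v v)))"

definition rotation_speed ::
  "'a::topological_space chart set \<Rightarrow> 'a metric \<Rightarrow> 'a connection \<Rightarrow> real set \<Rightarrow> (real \<Rightarrow> 'a) \<Rightarrow>
     (real \<Rightarrow> 'a tangent) \<Rightarrow> (real \<Rightarrow> 'a tangent) \<Rightarrow> real \<Rightarrow> real" where
  "rotation_speed A g nabla I \<gamma> Y Z t =
     g (\<gamma> t) (covariant_derivative_along A nabla I \<gamma> Y t) (cross_product A g (\<gamma> t) (Z t) (Y t))"


section \<open>Moving frames, indexed pencil bundles, tops\<close>

definition orthonormal_frame ::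
  "'a::topological_space chart set \<Rightarrow> 'a metric \<Rightarrow>
     ('a \<Rightarrow> 'a tangent) \<Rightarrow> ('a \<Rightarrow> 'a tangent) \<Rightarrow> ('a \<Rightarrow> 'a tangent) \<Rightarrow> bool" where
  "orthonormal_frame A g X\<^sub>1 X\<^sub>2 X\<^sub>3 \<longleftrightarrow>
     smooth_vector_field A UNIV X\<^sub>1 \<and> smooth_vector_field A UNIV X\<^sub>2 \<and>
     smooth_vector_field A UNIV X\<^sub>3 \<and>
     (\<forall>p. g p (X\<^sub>1 p) (X\<^sub>1 p) = 1 \<and> g p (X\<^sub>2 p) (X\<^sub>2 p) = 1 \<and> g p (X\<^sub>3 p) (X\<^sub>3 p) = 1 \<and>
          g p (X\<^sub>1 p) (X\<^sub>2 p) = 0 \<and> g p (X\<^sub>1 p) (X\<^sub>3 p) = 0 \<and> g p (X\<^sub>2 p) (X\<^sub>3 p) = 0)"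

definition pencil_plane ::
  "'a::topological_space chart set \<Rightarrow> ('a \<Rightarrow> 'a tangent \<Rightarrow> real) \<Rightarrow> ('a \<Rightarrow> 'a tangent \<Rightarrow> real) \<Rightarrow>
     real \<Rightarrow> 'a \<Rightarrow> 'a tangent set" where
  "pencil_plane A \<omega>\<^sub>1 \<omega>\<^sub>2 \<theta> p =
     {v \<in> tangent_space A p. cos \<theta> * \<omega>\<^sub>1 p v + sin \<theta> * \<omega>\<^sub>2 p v = 0}"

definition axis_bundle ::
  "'a::topological_space chart set \<Rightarrow> ('a \<Rightarrow> 'a tangent \<Rightarrow> real) \<Rightarrow> ('a \<Rightarrow> 'a tangent \<Rightarrow> real) \<Rightarrow>
     'a \<Rightarrow> 'a tangent set" where
  "axis_bundle A \<omega>\<^sub>1 \<omega>\<^sub>2 p = (\<Inter>\<theta>. pencil_plane A \<omega>\<^sub>1 \<omega>\<^sub>2 \<theta> p)"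

text \<open>
  The forms \<open>g(X\<^sub>i, \<cdot>)\<close> are the dual coframe of an orthonormal frame, so the axis bundle below is that
  of the pencil bundle defined by the first two forms of the dual coframe.
\<close>

definition determines_top ::
  "'a::topological_space chart set \<Rightarrow> 'a metric \<Rightarrow> 'a connection \<Rightarrow>
     ('a \<Rightarrow> 'a tangent) \<Rightarrow> ('a \<Rightarrow> 'a tangent) \<Rightarrow> ('a \<Rightarrow> 'a tangent) \<Rightarrow> bool" where
  "determines_top A g nabla X\<^sub>1 X\<^sub>2 X\<^sub>3 \<longleftrightarrow>
     (\<forall>I \<gamma>. arc_length_geodesic A g nabla I \<gamma> \<longrightarrow>
        (\<lambda>t. angle g (\<gamma> t) (velocity A \<gamma> t) (X\<^sub>3 (\<gamma> t))) constant_on I) \<and>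
     (\<forall>I \<gamma>. arc_length_geodesic A g nabla I \<gamma> \<and>
        (\<forall>t\<in>I. velocity A \<gamma> t \<notin> axis_bundle A (\<lambda>p. g p (X\<^sub>1 p)) (\<lambda>p. g p (X\<^sub>2 p)) (\<gamma> t)) \<longrightarrow>
        rotation_speed A g nabla I \<gamma> (\<lambda>t. X\<^sub>3 (\<gamma> t)) (velocity A \<gamma>) constant_on I) \<and>
     (\<forall>I \<gamma>. arc_length_geodesic A g nabla I \<gamma> \<longrightarrow>
        rotation_speed A g nabla I \<gamma> (\<lambda>t. X\<^sub>1 (\<gamma> t)) (\<lambda>t. X\<^sub>3 (\<gamma> t)) constant_on I) \<and>
     (\<forall>I \<gamma> J \<delta>. arc_length_geodesic A g nabla I \<gamma> \<and> arc_length_geodesic A g nabla J \<delta> \<and>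
        (\<forall>t\<in>I. \<forall>s\<in>J. angle g (\<gamma> t) (velocity A \<gamma> t) (X\<^sub>3 (\<gamma> t)) =
                      angle g (\<delta> s) (velocity A \<delta> s) (X\<^sub>3 (\<delta> s))) \<longrightarrow>
        (\<forall>t\<in>I. \<forall>s\<in>J.
           rotation_speed A g nabla I \<gamma> (\<lambda>t. X\<^sub>1 (\<gamma> t)) (\<lambda>t. X\<^sub>3 (\<gamma> t)) t =
           rotation_speed A g nabla J \<delta> (\<lambda>s. X\<^sub>1 (\<delta> s)) (\<lambda>s. X\<^sub>3 (\<delta> s)) s))"

end

(*
  Write nabla_(E_i) E_j = sum_k Gamma_ijk E_k in the orthonormal frame E = (X_1, X_2, X_3), so that
  Gamma_ijk = -Gamma_ikj, and let eps be the sign of the orientation of the frame, which is constant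
  as M is connected.  For a geodesic with velocity sum_i a_i E_i the geodesic equation reads
  a_k' = - sum_ij a_i a_j Gamma_ijk, and the two rotation speeds are
    R(X_3, velocity) = eps * (a_2 sum_i a_i Gamma_i31 - a_1 sum_i a_i Gamma_i32),
    R(X_1, X_3) = eps * sum_i a_i Gamma_i12.
  There is a geodesic in the direction of every unit vector.  Hence (i), read at time 0, says that
  X_3 is infinitesimally rotated, nabla_v X_3 = mu (v x X_3); then (ii) says that all vectors
  transverse to X_3 kill mu, so mu is constant; (iv), applied to v and -v orthogonal to X_3 and to
  X_3 at two points, gives Gamma_112 = Gamma_212 = 0 and Gamma_312 constant.  As nabla is torsion-free,
  these are exactly the bracket relations, with c = 2 mu and k = mu + Gamma_312.
*)
theory Submission
  imports Defs
begin


section \<open>Calculus of smooth functions on open sets\<close>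

text \<open>The conditions quantify over geodesics, while the bracket relations are pointwise;
  passing from one to the other needs a geodesic through every point in every unit direction. In
  frame components the geodesic equation is a first-order system on a chart image times
  \<open>real^3\<close>, which is solved by a contraction argument. The covariant derivative along a
  curve is a choice among operators satisfying axioms, so these axioms must be shown to be
  satisfiable and to fix its values. The global frame does both without cut-off functions, since
  every field along a curve is a combination of restrictions of the frame fields. The frame also
  identifies each tangent space isometrically with \<open>real^3\<close>, where the cross product
  becomes the standard one times eps. As eps is a nonzero factor of both rotation speeds, it never
  affects their constancy. Condition (ii) concerns transverse geodesics only: since (i) fixes the
  component along \<open>X_3\<close>, a geodesic that starts transverse stays so, and the derivative
  of mu in the direction \<open>X_3\<close> is recovered from transverse directions by
  linearity.\<close>

lemma k_smooth_on_cong: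
  assumes "open S" "\<And>x. x \<in> S \<Longrightarrow> f x = h x" "k_smooth_on k S f"
  shows "k_smooth_on k S h"
  using assms(2,3)
proof (induction k arbitrary: f h)
  case 0
  then show ?case by (metis continuous_on_cong k_smooth_on.simps(1))
next
  case (Suc k)
  have d: "(h has_derivative frechet_derivative f (at x)) (at x)" if "x \<in> S" for x
    using that Suc.prems assms(1)
    by (intro has_derivative_transform_within_open[of f _ x UNIV S h])
       (auto simp: frechet_derivative_works)
  have e: "frechet_derivative h (at x) = frechet_derivative f (at x)" if "x \<in> S" for x
    using d[OF that] by (rule frechet_derivative_at[symmetric])
  have "k_smooth_on k S (\<lambda>x. frechet_derivative h (at x) v)" for v
    by (rule Suc.IH[of "\<lambda>x. frechet_derivative f (at x) v"]) (use Suc.prems e in auto)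
  then show ?case using d by (auto simp: differentiable_def)
qed

lemma k_smooth_on_subset: "k_smooth_on k S f \<Longrightarrow> T \<subseteq> S \<Longrightarrow> k_smooth_on k T f"
  by (induction k arbitrary: f) (auto intro: continuous_on_subset)

lemma k_smooth_on_SucI:
  assumes "open S" "\<And>x. x \<in> S \<Longrightarrow> (f has_derivative f' x) (at x)"
    "\<And>v. k_smooth_on k S (\<lambda>x. f' x v)"
  shows "k_smooth_on (Suc k) S f"
proof -
  have "k_smooth_on k S (\<lambda>x. frechet_derivative f (at x) v)" for v
    by (rule k_smooth_on_cong[OF assms(1) _ assms(3)[of v]])
       (use frechet_derivative_at[OF assms(2)] in simp)
  then show ?thesis using assms(2) by (auto simp: differentiable_def)
qed

lemma k_smooth_on_continuous: "k_smooth_on k S f \<Longrightarrow> continuous_on S f"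
  by (cases k)
     (auto intro!: continuous_at_imp_continuous_on differentiable_imp_continuous_within)

text \<open>Level 0 of the recursion asks for continuity and the later levels only for derivatives,
  so lowering the order at the bottom uses that differentiability implies continuity.\<close>

lemma k_smooth_on_SucD: "k_smooth_on (Suc k) S f \<Longrightarrow> k_smooth_on k S f"
proof (induction k arbitrary: f)
  case 0
  then show ?case using k_smooth_on_continuous[OF 0] by simp
next
  case (Suc k)
  then show ?case by simp
qed

lemma k_smooth_on_has_derivative:
  "k_smooth_on (Suc k) S f \<Longrightarrow> x \<in> S \<Longrightarrow> (f has_derivative frechet_derivative f (at x)) (at x)"
  by (auto simp: frechet_derivative_works)

lemma k_smooth_on_local:
  assumes "\<And>x. x \<in> S \<Longrightarrow> \<exists>T. open T \<and> x \<in> T \<and> k_smooth_on k T f"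
  shows "k_smooth_on k S f"
  using assms
proof (induction k arbitrary: f)
  case 0
  then show ?case
    by (auto intro!: continuous_at_imp_continuous_on simp: continuous_on_eq_continuous_at) 
       (meson continuous_on_eq_continuous_at)
next
  case (Suc k)
  have "f differentiable (at x)" if "x \<in> S" for x
    using Suc.prems[OF that] by auto
  moreover have "k_smooth_on k S (\<lambda>x. frechet_derivative f (at x) v)" for v
    by (rule Suc.IH) (use Suc.prems in fastforce)
  ultimately show ?case by simp
qed

lemma k_smooth_on_const: "k_smooth_on k S (\<lambda>x. c)"
  by (induction k arbitrary: c) auto

lemma k_smooth_on_bounded_linear:
  assumes "bounded_linear f"
  shows "k_smooth_on k S f"
proof (cases k)
  case 0
  then show ?thesis using assms by (simp add: linear_continuous_on)
next
  case (Suc j)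
  have "frechet_derivative f (at x) = f" for x
    by (metis assms bounded_linear_imp_has_derivative frechet_derivative_at)
  then show ?thesis using assms Suc
    by (simp add: k_smooth_on_const bounded_linear_imp_differentiable)
qed

lemma k_smooth_on_add:
  assumes "open S" "k_smooth_on k S f" "k_smooth_on k S h"
  shows "k_smooth_on k S (\<lambda>x. f x + h x)"
  using assms(2,3)
proof (induction k arbitrary: f h)
  case (Suc k)
  show ?case
  proof (rule k_smooth_on_SucI[OF assms(1)])
    show "((\<lambda>x. f x + h x) has_derivative
        (\<lambda>v. frechet_derivative f (at x) v + frechet_derivative h (at x) v)) (at x)" if "x \<in> S" for x
      using Suc.prems that by (intro has_derivative_add k_smooth_on_has_derivative) auto
  qed (use Suc in auto)
qed (auto intro: continuous_on_add)

text \<open>By the product rule each derivative is a sum of two products in which one factor is left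
  undifferentiated. The induction therefore generalises over both factors, and the undifferentiated
  one is lowered by one order.\<close>

lemma (in bounded_bilinear) k_smooth_on:
  assumes "open S" "k_smooth_on k S f" "k_smooth_on k S h"
  shows "k_smooth_on k S (\<lambda>x. prod (f x) (h x))"
  using assms(2,3)
proof (induction k arbitrary: f h)
  case 0
  then show ?case by (auto intro: continuous_on)
next
  case (Suc k)
  show ?case
  proof (rule k_smooth_on_SucI[OF assms(1)])
    show "((\<lambda>x. prod (f x) (h x)) has_derivative
        (\<lambda>v. prod (f x) (frechet_derivative h (at x) v) + prod (frechet_derivative f (at x) v) (h x)))
        (at x)" if "x \<in> S" for x
      using Suc.prems that by (intro FDERIV k_smooth_on_has_derivative) auto
    show "k_smooth_on k S (\<lambda>x. prod (f x) (frechet_derivative h (at x) v)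
        + prod (frechet_derivative f (at x) v) (h x))" for v
      using Suc.prems k_smooth_on_SucD[OF Suc.prems(1)] k_smooth_on_SucD[OF Suc.prems(2)]
      by (intro k_smooth_on_add assms(1) Suc.IH) auto
  qed
qed

lemmas k_smooth_on_mult = bounded_bilinear.k_smooth_on[OF bounded_bilinear_mult]
lemmas k_smooth_on_scaleR = bounded_bilinear.k_smooth_on[OF bounded_bilinear_scaleR]

lemma k_smooth_on_sum:
  assumes "open S" "\<And>i. i \<in> B \<Longrightarrow> k_smooth_on k S (f i)"
  shows "k_smooth_on k S (\<lambda>x. \<Sum>i\<in>B. f i x)"
  using assms(2)
  by (induction B rule: infinite_finite_induct)
     (auto intro: k_smooth_on_const k_smooth_on_add[OF assms(1)])

lemma k_smooth_on_linear_comp: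
  assumes "open S" "bounded_linear L" "k_smooth_on k S f"
  shows "k_smooth_on k S (\<lambda>x. L (f x))"
  using assms(3)
proof (induction k arbitrary: f)
  case 0
  then show ?case using assms(2) by (auto intro: bounded_linear.continuous_on)
next
  case (Suc k)
  show ?case
  proof (rule k_smooth_on_SucI[OF assms(1)])
    show "((\<lambda>x. L (f x)) has_derivative (\<lambda>v. L (frechet_derivative f (at x) v))) (at x)"
      if "x \<in> S" for x
      using Suc.prems that 
      by (intro bounded_linear.has_derivative[OF assms(2)] k_smooth_on_has_derivative) auto
  qed (use Suc in auto)
qed

lemma k_smooth_on_compose:
  fixes f :: "'a::euclidean_space \<Rightarrow> 'b::euclidean_space"
  assumes "open S" "open T" "k_smooth_on k S f" "k_smooth_on k T h" "\<And>x. x \<in> S \<Longrightarrow> f x \<in> T"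
  shows "k_smooth_on k S (\<lambda>x. h (f x))"
  using assms(3,4)
proof (induction k arbitrary: h)
  case 0
  then show ?case using assms(5) by (auto intro: continuous_on_compose2)
next
  case (Suc k)
  \<comment> \<open>In the chain rule the direction fed to the derivative of \<open>h\<close> varies
    with \<open>x\<close>. Expanding it in \<open>Basis\<close> leaves only derivatives of
    \<open>h\<close> in fixed directions, composed with the same \<open>f\<close>, to which the
    induction hypothesis applies.\<close>
  define D where "D = (\<lambda>x v. \<Sum>b\<in>Basis. (frechet_derivative f (at x) v \<bullet> b) *\<^sub>R
      frechet_derivative h (at (f x)) b)"
  show ?case
  proof (rule k_smooth_on_SucI[OF assms(1)])
    fix x assume x: "x \<in> S"
    have df: "(f has_derivative frechet_derivative f (at x)) (at x)"
      using Suc.prems x by (intro k_smooth_on_has_derivative) auto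
    have dh: "(h has_derivative frechet_derivative h (at (f x))) (at (f x))"
      using Suc.prems x assms(5) by (intro k_smooth_on_has_derivative) auto
    have l: "linear (frechet_derivative h (at (f x)))"
      using dh has_derivative_linear by blast
    have eq: "frechet_derivative h (at (f x)) w
      = (\<Sum>b\<in>Basis. (w \<bullet> b) *\<^sub>R frechet_derivative h (at (f x)) b)" for w
      by (subst euclidean_representation[of w, symmetric])
         (simp only: linear_sum[OF l] linear_scale[OF l])
    have "D x = (\<lambda>v. frechet_derivative h (at (f x)) (frechet_derivative f (at x) v))"
      unfolding D_def by (rule ext, rule eq[symmetric])
    then show "((\<lambda>x. h (f x)) has_derivative D x) (at x)"
      using has_derivative_compose[OF df dh] by simp
  next
    fix v
    have "k_smooth_on k S (\<lambda>x. frechet_derivative f (at x) v)" using Suc.prems by simp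
    moreover have "k_smooth_on k S (\<lambda>x. frechet_derivative h (at (f x)) b)" for b
      by (rule Suc.IH[OF k_smooth_on_SucD[OF Suc.prems(1)]]) (use Suc.prems in auto)
    ultimately show "k_smooth_on k S (\<lambda>x. D x v)"
      unfolding D_def
      by (intro k_smooth_on_sum[OF assms(1)] k_smooth_on_scaleR[OF assms(1)]
          k_smooth_on_linear_comp[OF assms(1) bounded_linear_inner_left])
  qed
qed

section \<open>Smoothness of all orders and its closure properties\<close>

lemma smooth_on_cong:
  "open S \<Longrightarrow> smooth_on S f \<Longrightarrow> (\<And>x. x \<in> S \<Longrightarrow> f x = h x) \<Longrightarrow> smooth_on S h"
  unfolding smooth_on_def using k_smooth_on_cong by blast

lemma smooth_on_subset: "smooth_on S f \<Longrightarrow> T \<subseteq> S \<Longrightarrow> smooth_on T f"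
  unfolding smooth_on_def using k_smooth_on_subset by blast

lemma smooth_on_local:
  "(\<And>x. x \<in> S \<Longrightarrow> \<exists>T. open T \<and> x \<in> T \<and> smooth_on T f) \<Longrightarrow> smooth_on S f"
  unfolding smooth_on_def by (intro allI k_smooth_on_local) blast

lemma smooth_on_continuous: "smooth_on S f \<Longrightarrow> continuous_on S f"
  unfolding smooth_on_def using k_smooth_on_continuous by blast

lemma smooth_on_has_derivative:
  "smooth_on S f \<Longrightarrow> x \<in> S \<Longrightarrow> (f has_derivative frechet_derivative f (at x)) (at x)"
  unfolding smooth_on_def using k_smooth_on_has_derivative by blast

lemma smooth_on_frechet_derivative:
  "smooth_on S f \<Longrightarrow> smooth_on S (\<lambda>x. frechet_derivative f (at x) v)"
  unfolding smooth_on_def using k_smooth_on.simps(2)[of _ S f] by blast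

lemma smooth_on_const [intro]: "smooth_on S (\<lambda>x. c)"
  unfolding smooth_on_def by (simp add: k_smooth_on_const)

lemma smooth_on_bounded_linear: "bounded_linear f \<Longrightarrow> smooth_on S f"
  unfolding smooth_on_def by (simp add: k_smooth_on_bounded_linear)

lemma smooth_on_linear_comp:
  "open S \<Longrightarrow> bounded_linear L \<Longrightarrow> smooth_on S f \<Longrightarrow> smooth_on S (\<lambda>x. L (f x))"
  unfolding smooth_on_def by (simp add: k_smooth_on_linear_comp)

lemma smooth_on_add:
  "open S \<Longrightarrow> smooth_on S f \<Longrightarrow> smooth_on S h \<Longrightarrow> smooth_on S (\<lambda>x. f x + h x)"
  unfolding smooth_on_def by (simp add: k_smooth_on_add)

lemma smooth_on_mult:
  fixes f h :: "_ \<Rightarrow> real"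
  shows "open S \<Longrightarrow> smooth_on S f \<Longrightarrow> smooth_on S h \<Longrightarrow> smooth_on S (\<lambda>x. f x * h x)"
  unfolding smooth_on_def by (simp add: k_smooth_on_mult)

lemma smooth_on_scaleR:
  "open S \<Longrightarrow> smooth_on S f \<Longrightarrow> smooth_on S h \<Longrightarrow> smooth_on S (\<lambda>x. f x *\<^sub>R h x)"
  unfolding smooth_on_def by (simp add: k_smooth_on_scaleR)

lemma smooth_on_sum:
  "open S \<Longrightarrow> (\<And>i. i \<in> B \<Longrightarrow> smooth_on S (f i)) \<Longrightarrow> smooth_on S (\<lambda>x. \<Sum>i\<in>B. f i x)"
  unfolding smooth_on_def by (simp add: k_smooth_on_sum)

lemma smooth_on_compose:
  fixes f :: "'a::euclidean_space \<Rightarrow> 'b::euclidean_space"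
  assumes "open S" "open T" "smooth_on S f" "smooth_on T h" "\<And>x. x \<in> S \<Longrightarrow> f x \<in> T"
  shows "smooth_on S (\<lambda>x. h (f x))"
  unfolding smooth_on_def
  by (intro allI, rule k_smooth_on_compose[OF assms(1,2) _ _ assms(5)])
     (use assms in \<open>auto simp: smooth_on_def\<close>)

lemma smooth_on_vec_nth:
  fixes f :: "'a::euclidean_space \<Rightarrow> real^'n"
  shows "open S \<Longrightarrow> smooth_on S f \<Longrightarrow> smooth_on S (\<lambda>x. f x $ i)"
  by (rule smooth_on_linear_comp[OF _ bounded_linear_vec_nth])

lemma smooth_on_vec_lambda:
  fixes f :: "'a::euclidean_space \<Rightarrow> real^'n"
  assumes "open S" "\<And>i. smooth_on S (\<lambda>x. f x $ i)"
  shows "smooth_on S f"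
proof -
  have "smooth_on S (\<lambda>x. \<Sum>i\<in>UNIV. (f x $ i) *\<^sub>R axis i (1::real))"
    by (rule smooth_on_sum[OF assms(1)], rule smooth_on_scaleR[OF assms smooth_on_const])
  then show ?thesis
    by (rule smooth_on_cong[OF assms(1)])
       (simp add: vec_eq_iff axis_def if_distrib cong: if_cong)
qed

lemma smooth_on_Pair:
  fixes f :: "'a::euclidean_space \<Rightarrow> 'b::euclidean_space" and h :: "'a \<Rightarrow> 'c::euclidean_space"
  assumes "open S" "smooth_on S f" "smooth_on S h"
  shows "smooth_on S (\<lambda>x. (f x, h x))"
proof -
  have "smooth_on S (\<lambda>x. (f x, 0::'c))"
    by (rule smooth_on_linear_comp[OF assms(1) _ assms(2)])
       (rule bounded_linear_Pair[OF bounded_linear_ident bounded_linear_zero])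
  moreover have "smooth_on S (\<lambda>x. (0::'b, h x))"
    by (rule smooth_on_linear_comp[OF assms(1) _ assms(3)])
       (rule bounded_linear_Pair[OF bounded_linear_zero bounded_linear_ident])
  ultimately have "smooth_on S (\<lambda>x. (f x, 0) + (0, h x))"
    by (rule smooth_on_add[OF assms(1)])
  then show ?thesis by simp
qed

lemma smooth_on_curve_derivative:
  fixes f :: "real \<Rightarrow> 'b::real_normed_vector"
  assumes "open S" "smooth_on S f"
  shows "smooth_on S (\<lambda>t. vector_derivative f (at t))"
    and "\<And>t. t \<in> S \<Longrightarrow> (f has_vector_derivative vector_derivative f (at t)) (at t)"
proof -
  show *: "(f has_vector_derivative vector_derivative f (at t)) (at t)" if "t \<in> S" for t
    using smooth_on_has_derivative[OF assms(2) that]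
    using differentiableI vector_derivative_works by blast
  have "frechet_derivative f (at t) 1 = vector_derivative f (at t)" if "t \<in> S" for t
    using *[OF that] frechet_derivative_at[of f "\<lambda>x. x *\<^sub>R vector_derivative f (at t)" t]
    by (metis has_vector_derivative_def scaleR_one)
  then show "smooth_on S (\<lambda>t. vector_derivative f (at t))"
    by (rule smooth_on_cong[OF assms(1) smooth_on_frechet_derivative[OF assms(2), of 1]])
qed

lemma smooth_on_deriv:
  fixes f :: "real \<Rightarrow> real"
  assumes "open S" "smooth_on S f"
  shows "smooth_on S (deriv f)"
    and "\<And>t. t \<in> S \<Longrightarrow> (f has_real_derivative deriv f t) (at t)"
proof -
  show *: "(f has_real_derivative deriv f t) (at t)" if "t \<in> S" for t
    using smooth_on_has_derivative[OF assms(2) that]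
    by (metis DERIV_deriv_iff_real_differentiable differentiableI)
  have "vector_derivative f (at t) = deriv f t" if "t \<in> S" for t
    using *[OF that]
    by (simp add: has_real_derivative_iff_has_vector_derivative vector_derivative_at)
  then show "smooth_on S (deriv f)"
    by (rule smooth_on_cong[OF assms(1) smooth_on_curve_derivative(1)[OF assms]])
qed

text \<open>Bootstrapping: the right-hand side of \<open>y' = F(y)\<close> is as smooth as \<open>y\<close>.\<close>

lemma smooth_on_integral_curve:
  fixes y :: "real \<Rightarrow> 'b::euclidean_space"
  assumes "open S" "open T" "smooth_on T F" "\<And>t. t \<in> S \<Longrightarrow> y t \<in> T"
    and "\<And>t. t \<in> S \<Longrightarrow> (y has_vector_derivative F (y t)) (at t)"
  shows "smooth_on S y"
  unfolding smooth_on_def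
proof
  fix k show "k_smooth_on k S y"
  proof (induction k)
    case 0
    have "isCont y t" if "t \<in> S" for t
      using has_vector_derivative_continuous[OF assms(5)[OF that]] .
    then show ?case by (simp add: continuous_at_imp_continuous_on)
  next
    case (Suc k)
    have "k_smooth_on k S (\<lambda>t. F (y t))"
      by (rule k_smooth_on_compose[OF assms(1,2) Suc _ assms(4)])
         (use assms(3) in \<open>auto simp: smooth_on_def\<close>)
    then have *: "k_smooth_on k S (\<lambda>t. v *\<^sub>R F (y t))" for v
      by (rule k_smooth_on_scaleR[OF assms(1) k_smooth_on_const])
    show ?case
      by (rule k_smooth_on_SucI[OF assms(1) assms(5)[unfolded has_vector_derivative_def] *])
  qed
qed


section \<open>Charts, smooth functions and tangent vectors\<close>

locale smooth_manifold =
  fixes A :: "'a::t2_space chart set"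
  assumes atlas: "smooth_atlas A"
begin

lemma chart_homeomorphism:
  assumes "(U, \<phi>) \<in> A"
  shows "open U" "open (\<phi> ` U)" "homeomorphism U (\<phi> ` U) \<phi> (inv_into U \<phi>)"
  using atlas assms unfolding smooth_atlas_def is_chart_def by fast+

lemma chart_at: obtains U \<phi> where "(U, \<phi>) \<in> A" "p \<in> U"
proof -
  have "p \<in> (\<Union>c\<in>A. fst c)" using atlas unfolding smooth_atlas_def by blast
  then show ?thesis using that by fastforce
qed

lemma chart_inv [simp]: "(U, \<phi>) \<in> A \<Longrightarrow> p \<in> U \<Longrightarrow> inv_into U \<phi> (\<phi> p) = p"
  using chart_homeomorphism(3) by (auto simp: homeomorphism_def)

lemma open_chart_image:
  assumes "(U, \<phi>) \<in> A" "open W"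
  shows "open (\<phi> ` (U \<inter> W))"
proof -
  have "\<phi> ` (U \<inter> W) = inv_into U \<phi> -` W \<inter> \<phi> ` U"
    using chart_inv[OF assms(1)] by force
  then show ?thesis
    using chart_homeomorphism[OF assms(1)] assms(2)
    by (simp add: homeomorphism_def continuous_on_open_vimage)
qed

lemma smooth_on_transition:
  "(U, \<phi>) \<in> A \<Longrightarrow> (V, \<psi>) \<in> A \<Longrightarrow> smooth_on (\<phi> ` (U \<inter> V)) (\<lambda>x. \<psi> (inv_into U \<phi> x))"
  using atlas unfolding smooth_atlas_def comp_def by fast

lemma smooth_fun_chart:
  "smooth_fun A W f \<Longrightarrow> (U, \<phi>) \<in> A \<Longrightarrow> smooth_on (\<phi> ` (U \<inter> W)) (\<lambda>x. f (inv_into U \<phi> x))"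
  unfolding smooth_fun_def comp_def by fast

lemma smooth_funI:
  "(\<And>U \<phi>. (U, \<phi>) \<in> A \<Longrightarrow> smooth_on (\<phi> ` (U \<inter> W)) (\<lambda>x. f (inv_into U \<phi> x))) \<Longrightarrow> smooth_fun A W f"
  unfolding smooth_fun_def comp_def by fast

lemma smooth_fun_subset: "smooth_fun A W f \<Longrightarrow> V \<subseteq> W \<Longrightarrow> smooth_fun A V f"
  by (rule smooth_funI, rule smooth_on_subset[OF smooth_fun_chart]) auto

lemma smooth_nearI: "open W \<Longrightarrow> p \<in> W \<Longrightarrow> smooth_fun A W f \<Longrightarrow> smooth_near A p f"
  unfolding smooth_near_def by blast

text \<open>Any other chart expression differs from the given one by a transition map, so on a
  subset of a chart domain one chart decides smoothness.\<close>

lemma smooth_fun_chartI: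
  assumes ch: "(U, \<phi>) \<in> A" and V: "open V" "V \<subseteq> U"
    and f: "smooth_on (\<phi> ` V) (\<lambda>x. f (inv_into U \<phi> x))"
  shows "smooth_fun A V f"
proof (rule smooth_funI)
  fix U' \<psi> assume ch': "(U', \<psi>) \<in> A"
  have o: "open (\<psi> ` (U' \<inter> V))" using open_chart_image[OF ch' V(1)] .
  have o2: "open (\<phi> ` V)" using open_chart_image[OF ch V(1)] V(2) by (simp add: inf_absorb2)
  have "smooth_on (\<psi> ` (U' \<inter> V)) (\<lambda>x. f (inv_into U \<phi> (\<phi> (inv_into U' \<psi> x))))"
    by (rule smooth_on_compose[OF o o2 _ f])
       (rule smooth_on_subset[OF smooth_on_transition[OF ch' ch]], use ch' V in auto)
  then show "smooth_on (\<psi> ` (U' \<inter> V)) (\<lambda>x. f (inv_into U' \<psi> x))"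
    by (rule smooth_on_cong[OF o]) (use ch ch' V in auto)
qed

lemma smooth_fun_const [intro]: "smooth_fun A W (\<lambda>p. c)"
  by (rule smooth_funI) (rule smooth_on_const)

lemma smooth_fun_add:
  assumes "open W" "smooth_fun A W f" "smooth_fun A W h"
  shows "smooth_fun A W (\<lambda>p. f p + h p)"
  by (rule smooth_funI, rule smooth_on_add[OF open_chart_image[OF _ assms(1)]])
     (use assms smooth_fun_chart in auto)

lemma smooth_fun_mult:
  assumes "open W" "smooth_fun A W f" "smooth_fun A W h"
  shows "smooth_fun A W (\<lambda>p. f p * h p)"
  by (rule smooth_funI, rule smooth_on_mult[OF open_chart_image[OF _ assms(1)]])
     (use assms smooth_fun_chart in auto)

lemma smooth_fun_sum:
  assumes "open W" "\<And>i. i \<in> B \<Longrightarrow> smooth_fun A W (f i)"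
  shows "smooth_fun A W (\<lambda>p. \<Sum>i\<in>B. f i p)"
  using assms(2)
  by (induction B rule: infinite_finite_induct)
     (auto intro: smooth_fun_const smooth_fun_add[OF assms(1)])

lemma smooth_fun_coordinate:
  assumes "(U, \<phi>) \<in> A"
  shows "smooth_fun A U (\<lambda>q. \<phi> q $ i)"
  by (rule smooth_funI, rule smooth_on_vec_nth)
     (use assms smooth_on_transition open_chart_image chart_homeomorphism in auto)

lemma smooth_fun_continuous:
  assumes "open W" "smooth_fun A W f"
  shows "continuous_on W f"
proof -
  have "isCont f p" if "p \<in> W" for p
  proof -
    obtain U \<phi> where ch: "(U, \<phi>) \<in> A" and p: "p \<in> U" by (rule chart_at)
    have "continuous_on (U \<inter> W) (\<lambda>q. f (inv_into U \<phi> (\<phi> q)))"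
      by (rule continuous_on_compose2[OF smooth_on_continuous[OF smooth_fun_chart[OF assms(2) ch]]])
         (use chart_homeomorphism(3)[OF ch] in \<open>auto simp: homeomorphism_def intro: continuous_on_subset\<close>)
    then have "continuous_on (U \<inter> W) f"
      by (rule continuous_on_eq) (use ch in auto)
    then show ?thesis
      using chart_homeomorphism(1)[OF ch] assms(1) p that
      by (simp add: continuous_on_eq_continuous_at open_Int)
  qed
  then show ?thesis by (simp add: continuous_at_imp_continuous_on)
qed

lemma smooth_curve_open:
  assumes "smooth_curve A I \<gamma>" "open W"
  shows "open (I \<inter> \<gamma> -` W)"
  using assms unfolding smooth_curve_def open_interval_def
  by (metis Int_commute continuous_on_open_vimage)

lemma smooth_curve_chart:
  "smooth_curve A I \<gamma> \<Longrightarrow> (U, \<phi>) \<in> A \<Longrightarrow> smooth_on (I \<inter> \<gamma> -` U) (\<lambda>t. \<phi> (\<gamma> t))"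
  unfolding smooth_curve_def comp_def by fast

lemma smooth_curve_compose:
  assumes "smooth_curve A I \<gamma>" "open W" "smooth_fun A W f"
  shows "smooth_on (I \<inter> \<gamma> -` W) (\<lambda>t. f (\<gamma> t))"
proof (rule smooth_on_local)
  fix t assume t: "t \<in> I \<inter> \<gamma> -` W"
  obtain U \<phi> where ch: "(U, \<phi>) \<in> A" and p: "\<gamma> t \<in> U" by (rule chart_at)
  have o: "open (I \<inter> \<gamma> -` (U \<inter> W))"
    using smooth_curve_open[OF assms(1)] chart_homeomorphism(1)[OF ch] assms(2) by blast
  have "smooth_on (I \<inter> \<gamma> -` (U \<inter> W)) (\<lambda>t. f (inv_into U \<phi> (\<phi> (\<gamma> t))))"
    by (rule smooth_on_compose[OF o open_chart_image[OF ch assms(2)] _ smooth_fun_chart[OF assms(3) ch]])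
       (auto intro: smooth_on_subset[OF smooth_curve_chart[OF assms(1) ch]])
  then have "smooth_on (I \<inter> \<gamma> -` (U \<inter> W)) (\<lambda>t. f (\<gamma> t))"
    by (rule smooth_on_cong[OF o]) (use ch in auto)
  then show "\<exists>T. open T \<and> t \<in> T \<and> smooth_on T (\<lambda>t. f (\<gamma> t))"
    using o p t by blast
qed

lemma smooth_curve_chartI:
  assumes ch: "(U, \<phi>) \<in> A" and I: "open_interval I" and x: "smooth_on I x"
    and "\<And>t. t \<in> I \<Longrightarrow> x t \<in> \<phi> ` U"
  shows "smooth_curve A I (\<lambda>t. inv_into U \<phi> (x t))"
  unfolding smooth_curve_def
proof (intro conjI ballI)
  show c: "continuous_on I (\<lambda>t. inv_into U \<phi> (x t))"
    by (rule continuous_on_compose2[OF _ smooth_on_continuous[OF x]])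
       (use chart_homeomorphism(3)[OF ch] assms(4) in \<open>auto simp: homeomorphism_def\<close>)
  fix c assume "c \<in> A"
  then obtain V \<psi> where cc: "c = (V, \<psi>)" and ch': "(V, \<psi>) \<in> A" by (cases c) auto
  have "I \<inter> (\<lambda>t. inv_into U \<phi> (x t)) -` V = (\<lambda>t. inv_into U \<phi> (x t)) -` V \<inter> I" by blast
  then have o: "open (I \<inter> (\<lambda>t. inv_into U \<phi> (x t)) -` V)"
    using c I chart_homeomorphism(1)[OF ch'] 
    by (simp add: continuous_on_open_vimage open_interval_def)
  have "smooth_on (I \<inter> (\<lambda>t. inv_into U \<phi> (x t)) -` V) (\<lambda>t. \<psi> (inv_into U \<phi> (x t)))"
  proof (rule smooth_on_compose[OF o open_chart_image[OF ch chart_homeomorphism(1)[OF ch']] _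
        smooth_on_transition[OF ch ch']])
    show "smooth_on (I \<inter> (\<lambda>t. inv_into U \<phi> (x t)) -` V) x"
      using smooth_on_subset[OF x] by blast
    fix t assume t: "t \<in> I \<inter> (\<lambda>t. inv_into U \<phi> (x t)) -` V"
    then obtain q where "q \<in> U" "x t = \<phi> q" using assms(4) by blast
    then show "x t \<in> \<phi> ` (U \<inter> V)" using t ch by auto
  qed
  then show "case c of (U', \<phi>') \<Rightarrow> smooth_on (I \<inter> (\<lambda>t. inv_into U \<phi> (x t)) -` U')
      (\<phi>' \<circ> (\<lambda>t. inv_into U \<phi> (x t)))"
    by (simp add: cc comp_def)
qed (rule I)

text \<open>This is the tangent vector at \<open>p\<close> with components \<open>w\<close> in the
  chart. It vanishes on functions not smooth near \<open>p\<close>, as velocities do, so that it can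
  be equal to a velocity as an operator.\<close>

definition pd :: "'a set \<Rightarrow> ('a \<Rightarrow> real^3) \<Rightarrow> 'a \<Rightarrow> real^3 \<Rightarrow> 'a tangent" where
  "pd U \<phi> p w = (\<lambda>f. if smooth_near A p f
     then frechet_derivative (\<lambda>x. f (inv_into U \<phi> x)) (at (\<phi> p)) w else 0)"

lemma smooth_near_has_derivative:
  assumes "(U, \<phi>) \<in> A" "p \<in> U" "smooth_near A p f"
  shows "((\<lambda>x. f (inv_into U \<phi> x)) has_derivative (\<lambda>w. pd U \<phi> p w f)) (at (\<phi> p))"
proof -
  obtain W where "open W" "p \<in> W" "smooth_fun A W f"
    using assms(3) unfolding smooth_near_def by blast
  then have "((\<lambda>x. f (inv_into U \<phi> x)) has_derivative
      frechet_derivative (\<lambda>x. f (inv_into U \<phi> x)) (at (\<phi> p))) (at (\<phi> p))"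
    by (intro smooth_on_has_derivative[OF smooth_fun_chart[OF _ assms(1)]]) (use assms in auto)
  then show ?thesis using assms(3) by (simp add: pd_def)
qed

lemma pd_linear:
  assumes "(U, \<phi>) \<in> A" "p \<in> U"
  shows "linear (\<lambda>w. pd U \<phi> p w f)"
proof (cases "smooth_near A p f")
  case True
  then show ?thesis
    using smooth_near_has_derivative[OF assms] has_derivative_linear by blast
next
  case False
  then show ?thesis by (simp add: pd_def linear_iff)
qed

lemma pd_combination:
  assumes "(U, \<phi>) \<in> A" "p \<in> U"
  shows "pd U \<phi> p (a *\<^sub>R v + b *\<^sub>R w) = (\<lambda>f. a * pd U \<phi> p v f + b * pd U \<phi> p w f)"
  using pd_linear[OF assms] by (simp add: linear_iff fun_eq_iff)

lemma velocity_eq_pd: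
  assumes "smooth_curve A I \<gamma>" "t \<in> I" and ch: "(U, \<phi>) \<in> A" "\<gamma> t \<in> U"
  shows "velocity A \<gamma> t = pd U \<phi> (\<gamma> t) (vector_derivative (\<lambda>s. \<phi> (\<gamma> s)) (at t))"
proof
  fix f
  show "velocity A \<gamma> t f = pd U \<phi> (\<gamma> t) (vector_derivative (\<lambda>s. \<phi> (\<gamma> s)) (at t)) f"
  proof (cases "smooth_near A (\<gamma> t) f")
    case True
    have o: "open (I \<inter> \<gamma> -` U)"
      using smooth_curve_open[OF assms(1)] chart_homeomorphism(1)[OF ch(1)] .
    have t: "t \<in> I \<inter> \<gamma> -` U" using assms by blast
    have 1: "((\<lambda>s. \<phi> (\<gamma> s)) has_derivative
        (\<lambda>h. h *\<^sub>R vector_derivative (\<lambda>s. \<phi> (\<gamma> s)) (at t))) (at t)"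
      using smooth_on_curve_derivative(2)[OF o smooth_curve_chart[OF assms(1) ch(1)] t]
      by (simp add: has_vector_derivative_def)
    have "((\<lambda>s. f (inv_into U \<phi> (\<phi> (\<gamma> s)))) has_derivative
        (\<lambda>h. pd U \<phi> (\<gamma> t) (h *\<^sub>R vector_derivative (\<lambda>s. \<phi> (\<gamma> s)) (at t)) f)) (at t)"
      using has_derivative_compose[OF 1 smooth_near_has_derivative[OF ch True]] .
    then have "((\<lambda>s. f (\<gamma> s)) has_derivative
        (\<lambda>h. pd U \<phi> (\<gamma> t) (h *\<^sub>R vector_derivative (\<lambda>s. \<phi> (\<gamma> s)) (at t)) f)) (at t)"
      by (rule has_derivative_transform_within_open[OF _ o t]) (use ch in auto)
    then have "((\<lambda>s. f (\<gamma> s)) has_real_derivative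
        pd U \<phi> (\<gamma> t) (vector_derivative (\<lambda>s. \<phi> (\<gamma> s)) (at t)) f) (at t)"
      using pd_linear[OF ch]
      by (simp add: has_field_derivative_def linear_iff mult.commute[of _ "pd U \<phi> _ _ _"])
    then show ?thesis using True by (simp add: velocity_def DERIV_imp_deriv)
  qed (simp add: velocity_def pd_def)
qed

lemma velocity_chart_curve:
  assumes ch: "(U, \<phi>) \<in> A" and I: "open_interval I" and x: "smooth_on I x"
    and "\<And>t. t \<in> I \<Longrightarrow> x t \<in> \<phi> ` U" and t: "t \<in> I"
    and d: "(x has_vector_derivative w) (at t)"
  shows "velocity A (\<lambda>t. inv_into U \<phi> (x t)) t = pd U \<phi> (inv_into U \<phi> (x t)) w"
proof -
  have r: "\<phi> (inv_into U \<phi> (x s)) = x s" if "s \<in> I" for s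
    using assms(4)[OF that] by (simp add: f_inv_into_f)
  have "((\<lambda>s. \<phi> (inv_into U \<phi> (x s))) has_vector_derivative w) (at t)"
    by (rule has_vector_derivative_transform_within_open[OF d _ t])
       (use I r in \<open>auto simp: open_interval_def\<close>)
  then show ?thesis
    using velocity_eq_pd[OF smooth_curve_chartI[OF assms(1-4)] t ch] assms(4)[OF t]
    by (simp add: vector_derivative_at inv_into_into)
qed

text \<open>Tangent spaces are made of velocities at parameter 0 only; translating the parameter
  brings velocities at other times under that definition.\<close>

lemma smooth_curve_shift:
  assumes "smooth_curve A I \<gamma>"
  shows "smooth_curve A ((\<lambda>s. s - t) ` I) (\<lambda>s. \<gamma> (s + t))"
proof -
  let ?J = "(\<lambda>s. s - t) ` I"
  have J: "s \<in> ?J \<longleftrightarrow> s + t \<in> I" for s by force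
  have sm: "smooth_on T (\<lambda>s. s + t)" if "open T" for T :: "real set"
    by (rule smooth_on_add[OF that smooth_on_bounded_linear[OF bounded_linear_ident] smooth_on_const])
  have I: "open I" "is_interval I" "I \<noteq> {}"
    using assms unfolding smooth_curve_def open_interval_def by auto
  have "open ?J" using I(1) by (rule open_translation_subtract)
  moreover have "is_interval ?J" using I(2)
    by (simp add: is_interval_convex_1 convex_translation_subtract)
  moreover have "continuous_on ?J (\<lambda>s. \<gamma> (s + t))"
    by (rule continuous_on_compose2[of I \<gamma>])
       (use assms J in \<open>auto simp: smooth_curve_def intro!: continuous_intros\<close>)
  moreover have "smooth_on (?J \<inter> (\<lambda>s. \<gamma> (s + t)) -` U) (\<lambda>s. \<phi> (\<gamma> (s + t)))" if "(U, \<phi>) \<in> A" for U \<phi>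
  proof (rule smooth_on_compose[OF _ _ sm smooth_curve_chart[OF assms that]])
    show "open (I \<inter> \<gamma> -` U)"
      using smooth_curve_open[OF assms] chart_homeomorphism(1)[OF that] .
    have "?J \<inter> (\<lambda>s. \<gamma> (s + t)) -` U = (\<lambda>s. s - t) ` (I \<inter> \<gamma> -` U)" using J by force
    then show "open (?J \<inter> (\<lambda>s. \<gamma> (s + t)) -` U)"
      using \<open>open (I \<inter> \<gamma> -` U)\<close> by (simp add: open_translation_subtract)
    then show "open (?J \<inter> (\<lambda>s. \<gamma> (s + t)) -` U)" .
  qed (use J in auto)
  ultimately show ?thesis
    using assms unfolding smooth_curve_def open_interval_def by (auto simp: comp_def)
qed

lemma velocity_in_tangent_space:
  assumes "smooth_curve A I \<gamma>" "t \<in> I"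
  shows "velocity A \<gamma> t \<in> tangent_space A (\<gamma> t)"
proof -
  have "deriv (\<lambda>s. f (\<gamma> s)) t = deriv (\<lambda>s. f (\<gamma> (s + t))) 0" for f :: "'a \<Rightarrow> real"
    unfolding deriv_def using DERIV_at_within_shift[of "\<lambda>s. f (\<gamma> s)" _ t 0 UNIV] 
    by (simp add: add.commute)
  then have "velocity A \<gamma> t f = velocity A (\<lambda>s. \<gamma> (s + t)) 0 f" for f
    unfolding velocity_def by simp
  then have "velocity A \<gamma> t = velocity A (\<lambda>s. \<gamma> (s + t)) 0" ..
  moreover have "0 \<in> (\<lambda>s. s - t) ` I" using assms(2) by force
  ultimately show ?thesis
    using smooth_curve_shift[OF assms(1), of t] unfolding tangent_space_def by force
qed

text \<open>Velocities have this form by the chain rule. Conversely the direction \<open>w\<close>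
  is realised by the straight line through \<open>\<phi> p\<close>, pulled back from the
  chart.\<close>

lemma tangent_space_eq:
  assumes ch: "(U, \<phi>) \<in> A" "p \<in> U"
  shows "tangent_space A p = range (pd U \<phi> p)"
proof
  show "tangent_space A p \<subseteq> range (pd U \<phi> p)"
    using velocity_eq_pd ch unfolding tangent_space_def by blast
  show "range (pd U \<phi> p) \<subseteq> tangent_space A p"
  proof clarify
    fix w :: "real^3"
    obtain e where e: "e > 0" "ball (\<phi> p) e \<subseteq> \<phi> ` U"
      using chart_homeomorphism(2)[OF ch(1)] ch(2) by (meson imageI open_contains_ball)
    \<comment> \<open>With this bound the line moves by at most \<open>d * norm w\<close>, which is
      less than \<open>e\<close>; the summand 1 covers \<open>w = 0\<close>.\<close>
    define d where "d = e / (norm w + 1)"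
    have d: "d > 0" using e by (simp add: d_def add_nonneg_pos)
    define I where "I = {-d<..<d}"
    have I: "open_interval I" "0 \<in> I" using d by (auto simp: I_def open_interval_def)
    define x where "x = (\<lambda>t::real. \<phi> p + t *\<^sub>R w)"
    have dx: "(x has_vector_derivative w) (at t)" for t
      unfolding x_def by (auto intro!: derivative_eq_intros)
    have o: "open I" by (simp add: I_def)
    have "smooth_on I x"
      unfolding x_def
      by (intro smooth_on_add[OF o] smooth_on_const
          smooth_on_bounded_linear bounded_linear_scaleR_left)
    moreover have "x t \<in> \<phi> ` U" if "t \<in> I" for t
    proof -
      have n: "norm w + 1 > 0" by (simp add: add_nonneg_pos)
      have "\<bar>t\<bar> * norm w \<le> d * norm w" using that by (intro mult_right_mono) (auto simp: I_def)
      also have "\<dots> < e" using e n by (simp add: d_def field_simps)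
      finally show ?thesis using e by (auto simp: x_def dist_norm)
    qed
    ultimately have "velocity A (\<lambda>t. inv_into U \<phi> (x t)) 0 = pd U \<phi> p w"
      "smooth_curve A I (\<lambda>t. inv_into U \<phi> (x t))"
      using velocity_chart_curve[OF ch(1) I(1) _ _ I(2) dx] smooth_curve_chartI[OF ch(1) I(1)] ch
      by (auto simp: x_def)
    moreover have "inv_into U \<phi> (x 0) = p" using ch by (simp add: x_def)
    ultimately show "pd U \<phi> p w \<in> tangent_space A p"
      using I(2) unfolding tangent_space_def by force
  qed
qed

lemma chart_components_pd:
  assumes "(U, \<phi>) \<in> A" "p \<in> U"
  shows "chart_components \<phi> (pd U \<phi> p w) = w"
proof -
  have "pd U \<phi> p w (\<lambda>q. \<phi> q $ i) = w $ i" for i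
  proof -
    have n: "smooth_near A p (\<lambda>q. \<phi> q $ i)"
      by (rule smooth_nearI[OF chart_homeomorphism(1)[OF assms(1)] assms(2) smooth_fun_coordinate[OF assms(1)]])
    have "((\<lambda>x. x $ i) has_derivative (\<lambda>w. w $ i)) (at (\<phi> p))"
      by (rule bounded_linear_imp_has_derivative[OF bounded_linear_vec_nth])
    then have "((\<lambda>x. \<phi> (inv_into U \<phi> x) $ i) has_derivative (\<lambda>w. w $ i)) (at (\<phi> p))"
      by (rule has_derivative_transform_within_open[OF _ chart_homeomorphism(2)[OF assms(1)]])
         (use assms in \<open>auto simp: f_inv_into_f\<close>)
    from has_derivative_unique[OF this smooth_near_has_derivative[OF assms n]]
    show ?thesis by metis
  qed
  then show ?thesis by (simp add: chart_components_def vec_eq_iff)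
qed

lemma tangent_eq_pd:
  assumes "(U, \<phi>) \<in> A" "p \<in> U" "v \<in> tangent_space A p"
  shows "v = pd U \<phi> p (chart_components \<phi> v)"
  using assms chart_components_pd tangent_space_eq by force

text \<open>Curves on the manifold cannot be added, so closure under linear combinations is read off
  from the linear parametrisation by \<open>real^3\<close> in a chart.\<close>

lemma tangent_combination:
  assumes "u \<in> tangent_space A p" "v \<in> tangent_space A p"
  shows "(\<lambda>f. a * u f + b * v f) \<in> tangent_space A p"
proof -
  obtain U \<phi> where ch: "(U, \<phi>) \<in> A" "p \<in> U" by (rule chart_at)
  then obtain x y where "u = pd U \<phi> p x" "v = pd U \<phi> p y"
    using assms tangent_space_eq[OF ch] by blast
  then have "(\<lambda>f. a * u f + b * v f) = pd U \<phi> p (a *\<^sub>R x + b *\<^sub>R y)"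
    using pd_combination[OF ch] by simp
  then show ?thesis using tangent_space_eq[OF ch] by simp
qed

lemma tangent_zero: "(\<lambda>f. 0) \<in> tangent_space A p"
proof -
  obtain U \<phi> where ch: "(U, \<phi>) \<in> A" "p \<in> U" by (rule chart_at)
  have "(\<lambda>f. 0) = pd U \<phi> p 0" using linear_0[OF pd_linear[OF ch]] by auto
  then show ?thesis using tangent_space_eq[OF ch] by simp
qed

lemma tangent_sum:
  assumes "\<And>i. i \<in> B \<Longrightarrow> u i \<in> tangent_space A p"
  shows "(\<lambda>f. \<Sum>i\<in>B. a i * u i f) \<in> tangent_space A p"
  using assms
proof (induction B rule: infinite_finite_induct)
  case (insert i B)
  have "(\<lambda>f. a i * u i f + 1 * (\<Sum>i\<in>B. a i * u i f)) \<in> tangent_space A p"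
    by (rule tangent_combination) (use insert in auto)
  then show ?case using insert.hyps by simp
qed (auto simp: tangent_zero)

lemma tangent_const:
  assumes "v \<in> tangent_space A p"
  shows "v (\<lambda>q. c) = 0"
proof -
  obtain U \<phi> where ch: "(U, \<phi>) \<in> A" "p \<in> U" by (rule chart_at)
  have "pd U \<phi> p w (\<lambda>q. c) = 0" for w by (simp add: pd_def)
  then show ?thesis using assms tangent_eq_pd[OF ch] by metis
qed

section \<open>Smooth vector fields on open sets and along curves\<close>

lemma smooth_vector_field_subset:
  "smooth_vector_field A W X \<Longrightarrow> V \<subseteq> W \<Longrightarrow> smooth_vector_field A V X"
  unfolding smooth_vector_field_def by (metis subset_iff subset_trans)

lemma smooth_vector_field_pd:
  assumes ch: "(U, \<phi>) \<in> A"
  shows "smooth_vector_field A U (\<lambda>p. pd U \<phi> p w)"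
  unfolding smooth_vector_field_def
proof (intro conjI ballI allI impI)
  show "pd U \<phi> p w \<in> tangent_space A p" if "p \<in> U" for p
    using tangent_space_eq[OF ch that] by blast
  fix V f assume V: "open V \<and> V \<subseteq> U \<and> smooth_fun A V f"
  then have UV: "U \<inter> V = V" by blast
  have o: "open (\<phi> ` V)" using open_chart_image[OF ch, of V] V UV by simp
  have "smooth_on (\<phi> ` V) (\<lambda>x. f (inv_into U \<phi> x))"
    using smooth_fun_chart[OF _ ch, of V f] V UV by simp
  from smooth_on_frechet_derivative[OF this, of w] have "smooth_on (\<phi> ` V) (\<lambda>x. pd U \<phi> (inv_into U \<phi> x) w f)"
  proof (rule smooth_on_cong[OF o])
    fix x assume "x \<in> \<phi> ` V"
    then obtain q where q: "q \<in> V" "q \<in> U" "x = \<phi> q" using V by blast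
    then show "frechet_derivative (\<lambda>x. f (inv_into U \<phi> x)) (at x) w = pd U \<phi> (inv_into U \<phi> x) w f"
      using ch V smooth_nearI[of V q f] by (simp add: pd_def)
  qed
  then show "smooth_fun A V (\<lambda>p. pd U \<phi> p w f)"
    using V by (intro smooth_fun_chartI[OF ch]) auto
qed

lemma smooth_vector_field_sum:
  assumes "open W" "\<And>i. i \<in> B \<Longrightarrow> smooth_fun A W (a i)" "\<And>i. i \<in> B \<Longrightarrow> smooth_vector_field A W (X i)"
  shows "smooth_vector_field A W (\<lambda>p f. \<Sum>i\<in>B. a i p * X i p f)"
  using assms unfolding smooth_vector_field_def
  by (auto intro!: tangent_sum smooth_fun_sum smooth_fun_mult intro: smooth_fun_subset)

lemma velocity_apply:
  assumes "smooth_curve A I \<gamma>" "t \<in> I" "open W" "\<gamma> t \<in> W" "smooth_fun A W f"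
  shows "((\<lambda>s. f (\<gamma> s)) has_real_derivative velocity A \<gamma> t f) (at t)"
    and "velocity A \<gamma> t f = deriv (\<lambda>s. f (\<gamma> s)) t"
proof -
  show *: "velocity A \<gamma> t f = deriv (\<lambda>s. f (\<gamma> s)) t"
    using smooth_nearI[OF assms(3-5)] by (simp add: velocity_def)
  show "((\<lambda>s. f (\<gamma> s)) has_real_derivative velocity A \<gamma> t f) (at t)"
    unfolding * by (rule smooth_on_deriv(2)[OF smooth_curve_open[OF assms(1,3)]
        smooth_curve_compose[OF assms(1,3,5)]]) (use assms in auto)
qed

lemma smooth_vector_field_along_velocity:
  assumes "smooth_curve A I \<gamma>"
  shows "smooth_vector_field_along A I \<gamma> (velocity A \<gamma>)"
  unfolding smooth_vector_field_along_def
proof (intro conjI ballI allI impI)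
  fix W f assume W: "open W \<and> smooth_fun A W f"
  note o = smooth_curve_open[OF assms, of W]
  show "smooth_on (I \<inter> \<gamma> -` W) (\<lambda>t. velocity A \<gamma> t f)"
    by (rule smooth_on_cong[OF o smooth_on_deriv(1)[OF o smooth_curve_compose[OF assms]]])
       (use W velocity_apply(2)[OF assms] in auto)
qed (rule velocity_in_tangent_space[OF assms])

lemma smooth_vector_field_along_restrict:
  assumes "smooth_curve A I \<gamma>" "smooth_vector_field A UNIV X"
  shows "smooth_vector_field_along A I \<gamma> (\<lambda>t. X (\<gamma> t))"
  using assms(2) smooth_curve_compose[OF assms(1)]
  unfolding smooth_vector_field_along_def smooth_vector_field_def by blast

lemma smooth_vector_field_along_sum:
  assumes "smooth_curve A I \<gamma>" "\<And>i. i \<in> B \<Longrightarrow> smooth_on I (a i)"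
    "\<And>i. i \<in> B \<Longrightarrow> smooth_vector_field_along A I \<gamma> (V i)"
  shows "smooth_vector_field_along A I \<gamma> (\<lambda>t f. \<Sum>i\<in>B. a i t * V i t f)"
  using assms(2,3) smooth_curve_open[OF assms(1)] unfolding smooth_vector_field_along_def
  by (auto intro!: tangent_sum smooth_on_sum smooth_on_mult intro: smooth_on_subset)

text \<open>In a chart the derivative of \<open>f\<close> vanishes on a ball, which is connected, so
  \<open>f\<close> is constant near each point. Its level sets are then open as well as closed, and
  connectedness of the manifold makes a nonempty one the whole space.\<close>

lemma locally_constant_imp_constant:
  assumes "connected (UNIV :: 'a set)" "smooth_fun A UNIV f"
    and "\<And>p v. v \<in> tangent_space A p \<Longrightarrow> v f = 0"
  shows "f p = f q"
proof -
  have c: "continuous_on UNIV f" using smooth_fun_continuous[OF open_UNIV assms(2)] .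
  have "\<exists>V. open V \<and> x \<in> V \<and> (\<forall>y\<in>V. f y = f x)" for x
  proof -
    obtain U \<phi> where ch: "(U, \<phi>) \<in> A" and x: "x \<in> U" by (rule chart_at)
    obtain e where e: "e > 0" "ball (\<phi> x) e \<subseteq> \<phi> ` U"
      using chart_homeomorphism(2)[OF ch] x by (meson imageI open_contains_ball)
    define V where "V = U \<inter> \<phi> -` ball (\<phi> x) e"
    have "open V"
      using chart_homeomorphism(1,3)[OF ch]
      by (simp add: V_def homeomorphism_def Int_commute[of U] continuous_on_open_vimage)
    moreover have "f y = f x" if "y \<in> V" for y
    proof -
      have "(\<lambda>x. f (inv_into U \<phi> x)) (\<phi> y) = (\<lambda>x. f (inv_into U \<phi> x)) (\<phi> x)"
      proof (rule has_derivative_zero_unique_connected[of "ball (\<phi> x) e"])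
        fix z assume "z \<in> ball (\<phi> x) e"
        then obtain q where q: "q \<in> U" "z = \<phi> q" using e by blast
        have "smooth_near A q f" by (rule smooth_nearI[OF open_UNIV _ assms(2)]) simp
        moreover have "pd U \<phi> q w f = 0" for w
          using assms(3) tangent_space_eq[OF ch q(1)] by blast
        ultimately show "((\<lambda>x. f (inv_into U \<phi> x)) has_derivative (\<lambda>h. 0)) (at z)"
          using smooth_near_has_derivative[OF ch q(1), of f] q(2) by simp
      qed (use that e in \<open>auto simp: V_def\<close>)
      then show ?thesis using ch x that by (simp add: V_def)
    qed
    moreover have "x \<in> V" using x e by (simp add: V_def)
    ultimately show ?thesis by blast
  qed
  then have "\<exists>V. open V \<and> x \<in> V \<and> V \<subseteq> {y. f y = f q}" if "f x = f q" for x
    using that by (metis (mono_tags, lifting) mem_Collect_eq subsetI)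
  then have "open {y. f y = f q}"
    using open_subopen[of "{y. f y = f q}"] by simp
  moreover have "closed {y. f y = f q}"
    using closed_Collect_eq[OF c continuous_on_const] .
  ultimately have "{y. f y = f q} = UNIV"
    using connected_clopen[THEN iffD1, OF assms(1), rule_format, of "{y. f y = f q}"] by auto
  then show ?thesis by blast
qed

end


section \<open>Integral curves\<close>

text \<open>The mean value inequality for the primitive treats both orders of \<open>s\<close> and
  \<open>t\<close> at once. The contraction argument applies it to times on either side of
  0.\<close>

lemma integral_difference_bound:
  fixes f :: "real \<Rightarrow> 'b::banach"
  assumes "continuous_on {a..b} f" "\<And>t. t \<in> {a..b} \<Longrightarrow> norm (f t) \<le> B"
    and "s \<in> {a..b}" "t \<in> {a..b}"
  shows "norm (integral {a..s} f - integral {a..t} f) \<le> B * \<bar>s - t\<bar>"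
proof -
  have "norm (integral {a..s} f - integral {a..t} f) \<le> B * norm (s - t)"
  proof (rule differentiable_bound[of "{a..b}" _ "\<lambda>t h. h *\<^sub>R f t"])
    show "((\<lambda>u. integral {a..u} f) has_derivative (\<lambda>h. h *\<^sub>R f x)) (at x within {a..b})"
      if "x \<in> {a..b}" for x
      using integral_has_vector_derivative[OF assms(1) that] by (simp add: has_vector_derivative_def)
    show "onorm (\<lambda>h. h *\<^sub>R f x) \<le> B" if "x \<in> {a..b}" for x
      by (rule onorm_le) (use assms(2)[OF that] in \<open>simp add: mult.commute[of B] mult_left_mono\<close>)
  qed (use assms in auto)
  then show ?thesis by simp
qed

text \<open>The derivatives in basis directions are continuous, hence bounded on the compact ball;
  the sum of their bounds dominates the operator norm of the derivative, and convexity of the ball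
  gives the Lipschitz estimate.\<close>

lemma smooth_on_locally_lipschitz:
  fixes F :: "'b::euclidean_space \<Rightarrow> 'c::real_normed_vector"
  assumes "smooth_on T F" "cball y r \<subseteq> T"
  obtains L where "L \<ge> 0" "\<And>u v. u \<in> cball y r \<Longrightarrow> v \<in> cball y r \<Longrightarrow> norm (F u - F v) \<le> L * norm (u - v)"
proof -
  have "\<exists>K. \<forall>x\<in>cball y r. norm (frechet_derivative F (at x) b) \<le> K" for b
  proof -
    have "continuous_on (cball y r) (\<lambda>x. frechet_derivative F (at x) b)"
      using smooth_on_continuous[OF smooth_on_frechet_derivative[OF assms(1)]] assms(2)
      by (rule continuous_on_subset)
    then have "bounded ((\<lambda>x. frechet_derivative F (at x) b) ` cball y r)"
      by (intro compact_imp_bounded compact_continuous_image compact_cball)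
    then show ?thesis by (auto simp: bounded_iff)
  qed
  then obtain K where K: "\<And>b x. x \<in> cball y r \<Longrightarrow> norm (frechet_derivative F (at x) b) \<le> K b" by metis
  define L where "L = (\<Sum>b\<in>Basis. \<bar>K b\<bar>)"
  have "norm (F u - F v) \<le> L * norm (u - v)" if "u \<in> cball y r" "v \<in> cball y r" for u v
  proof (rule differentiable_bound[of "cball y r" F "\<lambda>x. frechet_derivative F (at x)"])
    fix x assume x: "x \<in> cball y r"
    have d: "(F has_derivative frechet_derivative F (at x)) (at x)"
      using smooth_on_has_derivative[OF assms(1)] assms(2) x by blast
    then show "(F has_derivative frechet_derivative F (at x)) (at x within cball y r)"
      by (rule has_derivative_at_withinI)
    have l: "linear (frechet_derivative F (at x))" using d has_derivative_linear by blast
    show "onorm (frechet_derivative F (at x)) \<le> L"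
    proof (rule onorm_le)
      fix w
      have "frechet_derivative F (at x) w = (\<Sum>b\<in>Basis. (w \<bullet> b) *\<^sub>R frechet_derivative F (at x) b)"
        by (subst euclidean_representation[of w, symmetric])
           (simp only: linear_sum[OF l] linear_scale[OF l])
      also have "norm \<dots> \<le> (\<Sum>b\<in>Basis. norm w * \<bar>K b\<bar>)"
      proof (rule sum_norm_le)
        fix b :: 'b assume b: "b \<in> Basis"
        have "norm (frechet_derivative F (at x) b) \<le> \<bar>K b\<bar>" using K[OF x, of b] by simp
        then show "norm ((w \<bullet> b) *\<^sub>R frechet_derivative F (at x) b) \<le> norm w * \<bar>K b\<bar>"
          using Basis_le_norm[OF b, of w] by (simp add: mult_mono)
      qed
      finally show "norm (frechet_derivative F (at x) w) \<le> L * norm w"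
        by (simp add: L_def sum_distrib_left mult.commute)
    qed
  qed (use that in auto)
  moreover have "L \<ge> 0" by (simp add: L_def sum_nonneg)
  ultimately show ?thesis using that by blast
qed

text \<open>Picard's argument: the integral equation is a fixed point problem for a contraction on
  the continuous functions with values in a closed ball about \<open>y0\<close>.\<close>

lemma integral_curve_exists:
  fixes F :: "'b::euclidean_space \<Rightarrow> 'b"
  assumes "open T" "y0 \<in> T" "smooth_on T F"
  obtains d y where "d > 0" "y 0 = y0" "\<And>t. t \<in> {-d<..<d} \<Longrightarrow> y t \<in> T"
    "\<And>t. t \<in> {-d<..<d} \<Longrightarrow> (y has_vector_derivative F (y t)) (at t)"
proof -
  obtain r where r: "r > 0" "cball y0 r \<subseteq> T"
    using assms open_contains_cball by blast
  obtain L where L: "L \<ge> 0"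
    "\<And>u v. u \<in> cball y0 r \<Longrightarrow> v \<in> cball y0 r \<Longrightarrow> norm (F u - F v) \<le> L * norm (u - v)"
    using smooth_on_locally_lipschitz[OF assms(3) r(2)] by metis
  have cF: "continuous_on (cball y0 r) F"
    using smooth_on_continuous[OF assms(3)] r(2) by (rule continuous_on_subset)
  then have "bounded (F ` cball y0 r)"
    by (intro compact_imp_bounded compact_continuous_image compact_cball)
  then obtain M where M: "M > 0" "\<And>u. u \<in> cball y0 r \<Longrightarrow> norm (F u) \<le> M"
    by (metis bounded_pos imageI)
  \<comment> \<open>The first bound keeps the iterates in the ball of radius \<open>r\<close>; the
    second makes the contraction factor \<open>L * d\<close> at most 1/2, the summand 1 covering
    \<open>L = 0\<close>.\<close>
  define d where "d = min (r / M) (1 / (2 * (L + 1)))"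
  have d: "d > 0" "M * d \<le> r" "L * d \<le> 1/2"
  proof -
    show "d > 0" using r M L by (simp add: d_def)
    have "M * d \<le> M * (r / M)" using M by (intro mult_left_mono) (auto simp: d_def)
    then show "M * d \<le> r" using M by simp
    have "L * d \<le> L * (1 / (2 * (L + 1)))" using L by (intro mult_left_mono) (auto simp: d_def)
    also have "\<dots> \<le> 1/2" using L by (simp add: field_simps)
    finally show "L * d \<le> 1/2" .
  qed
  \<comment> \<open>Clamping the time to \<open>{-d..d}\<close> extends the iterates to the whole
    real line, where the complete space of bounded continuous functions is available.\<close>
  define c where "c = (\<lambda>t. max (-d) (min d t))"
  have c: "c t \<in> {-d..d}" "\<bar>c t\<bar> \<le> d" for t using d(1) by (auto simp: c_def)
  have cc: "continuous_on UNIV c" unfolding c_def by (intro continuous_intros)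
  \<comment> \<open>The integral over \<open>{0..t}\<close> would be 0 for negative
    \<open>t\<close>; the difference of two integrals from \<open>-d\<close> gives the oriented
    integral from 0 to \<open>t\<close>.\<close>
  define J where "J = (\<lambda>f :: real \<Rightarrow>\<^sub>C 'b. \<lambda>t. y0 + (integral {-d..t} (\<lambda>s. F (f s)) - integral {-d..0} (\<lambda>s. F (f s))))"
  define S where "S = PiC (UNIV :: real set) (\<lambda>_. cball y0 r)"
  have S: "f \<in> S \<longleftrightarrow> (\<forall>t. f t \<in> cball y0 r)" for f
    by (simp add: S_def mem_PiC_iff Pi_iff)
  have cFf: "continuous_on X (\<lambda>s. F (f s))" if "f \<in> S" for f X
    by (rule continuous_on_compose2[OF cF]) (use that S in auto)
  have J_diff: "(J f has_vector_derivative F (f t)) (at t within {-d..d})" if "f \<in> S" "t \<in> {-d..d}" for f t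
    unfolding J_def using integral_has_vector_derivative[OF cFf[OF that(1)] that(2)]
    by (auto intro!: derivative_eq_intros)
  have J_bound: "J f t \<in> cball y0 r" if "f \<in> S" "t \<in> {-d..d}" for f t
  proof -
    have "norm (integral {-d..t} (\<lambda>s. F (f s)) - integral {-d..0} (\<lambda>s. F (f s))) \<le> M * \<bar>t - 0\<bar>"
      by (rule integral_difference_bound[OF cFf[OF that(1)]]) (use M(2) that S d in auto)
    also have "\<dots> \<le> M * d" using that M(1) by (intro mult_left_mono) auto
    finally show ?thesis using d(2) by (simp add: J_def dist_norm norm_minus_commute)
  qed
  define \<Phi> where "\<Phi> = (\<lambda>f. Bcontfun (\<lambda>t. J f (c t)))"
  have \<Phi>: "\<Phi> f t = J f (c t)" if "f \<in> S" for f t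
  proof -
    have "continuous_on {-d..d} (J f)"
      using J_diff[OF that] by (meson continuous_on_vector_derivative)
    then have "continuous_on UNIV (\<lambda>t. J f (c t))"
      by (rule continuous_on_compose2[OF _ cc]) (use c in auto)
    moreover have "bounded (range (\<lambda>t. J f (c t)))"
      by (rule bounded_subset[OF bounded_cball[of y0 r]]) (use J_bound[OF that] c in auto)
    ultimately have "(\<lambda>t. J f (c t)) \<in> bcontfun" by (simp add: bcontfun_def)
    then show ?thesis by (simp add: \<Phi>_def Bcontfun_inverse)
  qed
  have "\<exists>!f. f \<in> S \<and> \<Phi> f = f"
  proof (rule Banach_fix)
    show "complete S" unfolding S_def by (simp add: complete_eq_closed closed_PiC)
    have "const_bcontfun y0 \<in> S" using r by (simp add: S const_bcontfun.rep_eq)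
    then show "S \<noteq> {}" by blast
    show "\<Phi> ` S \<subseteq> S" using J_bound c \<Phi> S by auto
    show "dist (\<Phi> f) (\<Phi> h) \<le> 1/2 * dist f h" if "f \<in> S" "h \<in> S" for f h
    proof (rule dist_bound)
      fix t
      have lip: "norm (F (f s) - F (h s)) \<le> L * dist f h" for s
      proof -
        have "norm (F (f s) - F (h s)) \<le> L * norm (f s - h s)" using L(2) that S by blast
        also have "\<dots> \<le> L * dist f h"
          using dist_bounded[of f s h] L(1) by (intro mult_left_mono) (auto simp: dist_norm)
        finally show ?thesis .
      qed
      have int: "integral {-d..u} (\<lambda>s. F (f s)) - integral {-d..u} (\<lambda>s. F (h s))
          = integral {-d..u} (\<lambda>s. F (f s) - F (h s))" for u
        by (intro integral_diff[symmetric] integrable_continuous_real cFf that)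
      have "J f (c t) - J h (c t) = integral {-d..c t} (\<lambda>s. F (f s) - F (h s))
          - integral {-d..0} (\<lambda>s. F (f s) - F (h s))"
        unfolding J_def int[symmetric] by simp
      also have "norm \<dots> \<le> L * dist f h * \<bar>c t - 0\<bar>"
        by (rule integral_difference_bound[of _ d])
           (use lip c d in \<open>auto intro!: continuous_on_diff cFf that\<close>)
      also have "\<dots> \<le> L * dist f h * d"
        using c L(1) by (intro mult_left_mono) auto
      also have "\<dots> = (L * d) * dist f h" by simp
      also have "\<dots> \<le> 1/2 * dist f h" using d(3) by (intro mult_right_mono) auto
      finally show "dist (\<Phi> f t) (\<Phi> h t) \<le> 1/2 * dist f h"
        using that by (simp add: \<Phi> dist_norm)
    qed
  qed auto
  then obtain f where f: "f \<in> S" "\<Phi> f = f" by blast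
  \<comment> \<open>Clamping is the identity on \<open>{-d..d}\<close>, so there the fixed point
    solves the original integral equation.\<close>
  have eq: "J f t = f t" if "t \<in> {-d..d}" for t
    using \<Phi>[OF f(1), of t] that f(2) by (simp add: c_def)
  show ?thesis
  proof (rule that[of d "apply_bcontfun f"])
    show "f 0 = y0" using eq[of 0] d(1) by (simp add: J_def)
    show "f t \<in> T" for t using f(1) S r(2) by blast
    fix t assume t: "t \<in> {-d<..<d}"
    have "(J f has_vector_derivative F (f t)) (at t within {-d<..<d})"
      by (rule has_vector_derivative_within_subset[OF J_diff[OF f(1)]]) (use t in auto)
    then have "(J f has_vector_derivative F (f t)) (at t)"
      by (simp only: at_within_open[OF t open_greaterThanLessThan])
    then show "(f has_vector_derivative F (f t)) (at t)"
      by (rule has_vector_derivative_transform_within_open[OF _ open_greaterThanLessThan t])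
         (use eq in auto)
  qed (rule d(1))
qed


section \<open>Orthonormal frames and the Levi-Civita connection\<close>

locale framed_manifold = smooth_manifold A
  for A :: "'a::t2_space chart set" +
  fixes g :: "'a metric" and nabla :: "'a connection" and E :: "3 \<Rightarrow> 'a \<Rightarrow> 'a tangent"
  assumes metric: "riemannian_metric A g"
    and levi_civita: "levi_civita A g nabla"
    and E_smooth: "\<And>i. smooth_vector_field A UNIV (E i)"
    and E_orthonormal: "\<And>i j p. g p (E i p) (E j p) = (if i = j then 1 else 0)"
begin

lemma E_tangent: "E i p \<in> tangent_space A p"
  using E_smooth unfolding smooth_vector_field_def by blast

lemma g_combination_left:
  "u \<in> tangent_space A p \<Longrightarrow> v \<in> tangent_space A p \<Longrightarrow> w \<in> tangent_space A p \<Longrightarrow>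
   g p (\<lambda>f. a * u f + b * v f) w = a * g p u w + b * g p v w"
  using metric[unfolded riemannian_metric_def, THEN conjunct1] by blast

lemma g_sym: "u \<in> tangent_space A p \<Longrightarrow> v \<in> tangent_space A p \<Longrightarrow> g p u v = g p v u"
  using metric[unfolded riemannian_metric_def, THEN conjunct2, THEN conjunct1] by blast

lemma g_smooth:
  "open W \<Longrightarrow> smooth_vector_field A W X \<Longrightarrow> smooth_vector_field A W Y \<Longrightarrow>
   smooth_fun A W (\<lambda>p. g p (X p) (Y p))"
  using metric[unfolded riemannian_metric_def, THEN conjunct2, THEN conjunct2, THEN conjunct2] by blast

lemma g_add_left:
  assumes "u \<in> tangent_space A p" "v \<in> tangent_space A p" "w \<in> tangent_space A p"
  shows "g p (\<lambda>f. u f + v f) w = g p u w + g p v w"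
  using g_combination_left[OF assms, of 1 1] by simp

lemma g_scale_left:
  assumes "u \<in> tangent_space A p" "w \<in> tangent_space A p"
  shows "g p (\<lambda>f. a * u f) w = a * g p u w"
  using g_combination_left[OF assms(1,1,2), of a 0] by simp

lemma g_sum_left:
  assumes "finite B" "\<And>i. i \<in> B \<Longrightarrow> u i \<in> tangent_space A p" "w \<in> tangent_space A p"
  shows "g p (\<lambda>f. \<Sum>i\<in>B. a i * u i f) w = (\<Sum>i\<in>B. a i * g p (u i) w)"
  using assms(1,2)
proof (induction B)
  case empty
  show ?case using g_combination_left[OF assms(3,3,3), of 0 0] by simp
next
  case (insert i B)
  have "g p (\<lambda>f. a i * u i f + 1 * (\<Sum>i\<in>B. a i * u i f)) w
      = a i * g p (u i) w + 1 * g p (\<lambda>f. \<Sum>i\<in>B. a i * u i f) w"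
    by (rule g_combination_left) (use insert assms(3) in \<open>auto intro: tangent_sum\<close>)
  then show ?case using insert by simp
qed

section \<open>Tangent vectors as triples of frame components\<close>

definition frame_vec :: "'a \<Rightarrow> real^3 \<Rightarrow> 'a tangent" where
  "frame_vec p a = (\<lambda>f. \<Sum>i\<in>UNIV. a $ i * E i p f)"

definition frame_comp :: "'a \<Rightarrow> 'a tangent \<Rightarrow> real^3" where
  "frame_comp p v = (\<chi> i. g p v (E i p))"

lemma frame_vec_tangent: "frame_vec p a \<in> tangent_space A p"
  unfolding frame_vec_def by (rule tangent_sum) (rule E_tangent)

lemma frame_comp_vec [simp]: "frame_comp p (frame_vec p a) = a"
  unfolding frame_comp_def frame_vec_def
  by (simp add: g_sum_left E_tangent E_orthonormal vec_eq_iff if_distrib cong: if_cong)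

lemma frame_vec_combination:
  "frame_vec p (a *\<^sub>R v + b *\<^sub>R w) = (\<lambda>f. a * frame_vec p v f + b * frame_vec p w f)"
  by (simp add: frame_vec_def fun_eq_iff sum.distrib sum_distrib_left algebra_simps)

lemma frame_vec_scaleR: "frame_vec p (a *\<^sub>R v) = (\<lambda>f. a * frame_vec p v f)"
  using frame_vec_combination[of p a v 0 0] by simp

lemma frame_vec_zero: "frame_vec p 0 = (\<lambda>f. 0)"
  using frame_vec_scaleR[of p 0 0] by simp

lemma frame_vec_axis: "frame_vec p (axis i 1) = E i p"
  by (simp add: frame_vec_def axis_def fun_eq_iff if_distrib[of "\<lambda>x. x * _"] cong: if_cong)

lemma frame_vec_inject [simp]: "frame_vec p a = frame_vec p b \<longleftrightarrow> a = b"
  by (metis frame_comp_vec)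

lemma chart_components_sum:
  "chart_components \<phi> (\<lambda>f. \<Sum>i\<in>B. a i * u i f) = (\<Sum>i\<in>B. a i *\<^sub>R chart_components \<phi> (u i))"
  by (simp add: chart_components_def vec_eq_iff)

text \<open>Orthonormality makes the map from coefficients to tangent vectors injective. Followed by
  chart components it is an injective linear endomorphism of \<open>real^3\<close>, hence onto, so
  the frame spans.\<close>

lemma tangent_eq_frame_vec:
  assumes "v \<in> tangent_space A p"
  shows "v = frame_vec p (frame_comp p v)"
proof -
  obtain U \<phi> where ch: "(U, \<phi>) \<in> A" "p \<in> U" by (rule chart_at)
  define L where "L = (\<lambda>a. chart_components \<phi> (frame_vec p a))"
  have L: "pd U \<phi> p (L a) = frame_vec p a" for a
    using tangent_eq_pd[OF ch frame_vec_tangent] by (simp add: L_def)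
  have "linear L"
    unfolding L_def frame_vec_def chart_components_sum
    by (intro linearI) (simp_all add: sum.distrib algebra_simps scaleR_sum_right)
  moreover have "inj L" by (metis L frame_vec_inject injI)
  ultimately have "surj L" by (rule linear_injective_imp_surjective) simp
  then obtain a where "chart_components \<phi> v = L a" by blast
  then have "v = frame_vec p a" using tangent_eq_pd[OF ch assms] L by simp
  then show ?thesis by simp
qed

lemma g_frame_vec: "g p (frame_vec p a) (frame_vec p b) = a \<bullet> b"
proof -
  have "g p (frame_vec p a) (frame_vec p b) = (\<Sum>i\<in>UNIV. a $ i * g p (E i p) (frame_vec p b))"
    unfolding frame_vec_def[of p a] by (rule g_sum_left) (auto simp: E_tangent frame_vec_tangent)
  moreover have "g p (E i p) (frame_vec p b) = b $ i" for i
    using arg_cong[OF frame_comp_vec, of "\<lambda>v. v $ i" p b] g_sym[OF E_tangent frame_vec_tangent]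
    by (simp add: frame_comp_def)
  ultimately show ?thesis by (simp add: inner_vec_def)
qed

lemma smooth_vector_field_frame_comp:
  assumes "smooth_vector_field A UNIV Y"
  shows "smooth_fun A UNIV (\<lambda>p. frame_comp p (Y p) $ i)"
  unfolding frame_comp_def using g_smooth[OF open_UNIV assms E_smooth] by simp

section \<open>Connection coefficients in the frame\<close>

definition \<Gamma> :: "3 \<Rightarrow> 3 \<Rightarrow> 3 \<Rightarrow> 'a \<Rightarrow> real" where
  "\<Gamma> i j k p = g p (nabla p (E i p) (E j)) (E k p)"

lemma nabla_combination:
  "smooth_vector_field A UNIV Y \<Longrightarrow> u \<in> tangent_space A p \<Longrightarrow> v \<in> tangent_space A p \<Longrightarrow>
   nabla p (\<lambda>f. a * u f + b * v f) Y = (\<lambda>f. a * nabla p u Y f + b * nabla p v Y f)"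
  using levi_civita[unfolded levi_civita_def affine_connection_def,
      THEN conjunct1, THEN conjunct1] by blast

lemma nabla_add:
  "smooth_vector_field A UNIV Y \<Longrightarrow> smooth_vector_field A UNIV Z \<Longrightarrow> v \<in> tangent_space A p \<Longrightarrow>
   nabla p v (\<lambda>q f. Y q f + Z q f) = (\<lambda>f. nabla p v Y f + nabla p v Z f)"
  using levi_civita[unfolded levi_civita_def affine_connection_def,
      THEN conjunct1, THEN conjunct2, THEN conjunct1] by blast

lemma nabla_leibniz:
  "smooth_fun A UNIV h \<Longrightarrow> smooth_vector_field A UNIV Y \<Longrightarrow> v \<in> tangent_space A p \<Longrightarrow>
   nabla p v (\<lambda>q f. h q * Y q f) = (\<lambda>f. v h * Y p f + h p * nabla p v Y f)"
  using levi_civita[unfolded levi_civita_def affine_connection_def,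
      THEN conjunct1, THEN conjunct2, THEN conjunct2, THEN conjunct1] by blast

lemma nabla_smooth:
  "smooth_vector_field A UNIV X \<Longrightarrow> smooth_vector_field A UNIV Y \<Longrightarrow>
   smooth_vector_field A UNIV (\<lambda>p. nabla p (X p) Y)"
  using levi_civita[unfolded levi_civita_def affine_connection_def,
      THEN conjunct1, THEN conjunct2, THEN conjunct2, THEN conjunct2, THEN conjunct1] by blast

lemma nabla_tangent:
  "smooth_vector_field A UNIV Y \<Longrightarrow> v \<in> tangent_space A p \<Longrightarrow> nabla p v Y \<in> tangent_space A p"
  using levi_civita[unfolded levi_civita_def affine_connection_def,
      THEN conjunct1, THEN conjunct2, THEN conjunct2, THEN conjunct2, THEN conjunct2] by blast

lemma nabla_metric:
  "smooth_vector_field A UNIV Y \<Longrightarrow> smooth_vector_field A UNIV Z \<Longrightarrow> v \<in> tangent_space A p \<Longrightarrow>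
   v (\<lambda>q. g q (Y q) (Z q)) = g p (nabla p v Y) (Z p) + g p (Y p) (nabla p v Z)"
  using levi_civita[unfolded levi_civita_def, THEN conjunct2, THEN conjunct2] by blast

lemma nabla_torsion:
  "smooth_vector_field A UNIV X \<Longrightarrow> smooth_vector_field A UNIV Y \<Longrightarrow>
   lie_bracket A X Y p f = nabla p (X p) Y f - nabla p (Y p) X f"
  using levi_civita[unfolded levi_civita_def, THEN conjunct2, THEN conjunct1, rule_format, of X Y]
  by (metis (no_types, lifting))

lemma \<Gamma>_smooth: "smooth_fun A UNIV (\<Gamma> i j k)"
  unfolding \<Gamma>_def by (rule g_smooth[OF open_UNIV nabla_smooth[OF E_smooth E_smooth] E_smooth])

text \<open>The products of the frame fields are constant functions, so metric compatibility
  differentiates them to 0.\<close>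

lemma \<Gamma>_antisym: "\<Gamma> i j k p = - \<Gamma> i k j p"
proof -
  have "E i p (\<lambda>q. g q (E j q) (E k q)) = 0"
    unfolding E_orthonormal by (rule tangent_const[OF E_tangent])
  then show ?thesis
    using nabla_metric[OF E_smooth[of j] E_smooth[of k] E_tangent[of i p]]
      g_sym[OF E_tangent[of j p] nabla_tangent[OF E_smooth[of k] E_tangent[of i p]]]
    by (simp add: \<Gamma>_def)
qed

lemma \<Gamma>_diag [simp]: "\<Gamma> i j j p = 0"
  using \<Gamma>_antisym[of i j j p] by simp

lemma nabla_E: "nabla p (E i p) (E j) = frame_vec p (\<chi> k. \<Gamma> i j k p)"
  using tangent_eq_frame_vec[OF nabla_tangent[OF E_smooth E_tangent]]
  by (simp add: frame_comp_def \<Gamma>_def)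

lemma nabla_sum:
  assumes Y: "smooth_vector_field A UNIV Y" and "finite B" "\<And>i. i \<in> B \<Longrightarrow> u i \<in> tangent_space A p"
  shows "nabla p (\<lambda>f. \<Sum>i\<in>B. a i * u i f) Y = (\<lambda>f. \<Sum>i\<in>B. a i * nabla p (u i) Y f)"
  using assms(2,3)
proof (induction B)
  case empty
  show ?case using nabla_combination[OF Y tangent_zero tangent_zero, of p 0 0] by simp
next
  case (insert i B)
  have "nabla p (\<lambda>f. a i * u i f + 1 * (\<Sum>i\<in>B. a i * u i f)) Y
      = (\<lambda>f. a i * nabla p (u i) Y f + 1 * nabla p (\<lambda>f. \<Sum>i\<in>B. a i * u i f) Y f)"
    by (rule nabla_combination[OF Y]) (use insert in \<open>auto intro: tangent_sum\<close>)
  then show ?case using insert by simp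
qed

lemma nabla_frame_vec:
  "nabla p (frame_vec p a) (E j) = frame_vec p (\<chi> k. \<Sum>i\<in>UNIV. a $ i * \<Gamma> i j k p)"
proof -
  have "nabla p (frame_vec p a) (E j) = (\<lambda>f. \<Sum>i\<in>UNIV. a $ i * frame_vec p (\<chi> k. \<Gamma> i j k p) f)"
    unfolding frame_vec_def[of p a] nabla_E[symmetric]
    by (rule nabla_sum[OF E_smooth]) (auto simp: E_tangent)
  also have "\<dots> = frame_vec p (\<chi> k. \<Sum>i\<in>UNIV. a $ i * \<Gamma> i j k p)"
    by (simp add: frame_vec_def fun_eq_iff sum_3 algebra_simps)
  finally show ?thesis .
qed

text \<open>Vanishing torsion expresses the bracket as an antisymmetrised covariant derivative; this
  is the only link between brackets and \<Gamma>.\<close>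

lemma lie_bracket_E:
  "lie_bracket A (E i) (E j) p = frame_vec p (\<chi> k. \<Gamma> i j k p - \<Gamma> j i k p)"
proof
  fix f
  have "(\<chi> k. \<Gamma> i j k p - \<Gamma> j i k p) = 1 *\<^sub>R (\<chi> k. \<Gamma> i j k p) + (-1) *\<^sub>R (\<chi> k. \<Gamma> j i k p)"
    by (simp add: vec_eq_iff)
  then show "lie_bracket A (E i) (E j) p f = frame_vec p (\<chi> k. \<Gamma> i j k p - \<Gamma> j i k p) f"
    by (simp only: nabla_torsion[OF E_smooth E_smooth] nabla_E frame_vec_combination)
qed

section \<open>Covariant derivative along curves\<close>

text \<open>Smoothness along a curve is defined by the action on functions, whereas frame components
  are metric products. The coordinate frame mediates: the coordinate components of \<open>V\<close>
  are its values on coordinate functions, and the products of coordinate fields with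
  \<open>E i\<close> are smooth on the chart domain.\<close>

lemma frame_comp_smooth_along:
  assumes \<gamma>: "smooth_curve A I \<gamma>" and V: "smooth_vector_field_along A I \<gamma> V"
  shows "smooth_on I (\<lambda>t. frame_comp (\<gamma> t) (V t) $ i)"
proof (rule smooth_on_local)
  fix t0 assume "t0 \<in> I"
  obtain U \<phi> where ch: "(U, \<phi>) \<in> A" and U: "\<gamma> t0 \<in> U" by (rule chart_at)
  define T where "T = I \<inter> \<gamma> -` U"
  have oU: "open U" using chart_homeomorphism(1)[OF ch] .
  have o: "open T" unfolding T_def by (rule smooth_curve_open[OF \<gamma> oU])
  have "smooth_on T (\<lambda>t. V t (\<lambda>q. \<phi> q $ j))" for j
    using V oU smooth_fun_coordinate[OF ch] unfolding T_def smooth_vector_field_along_def by blast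
  moreover have "smooth_on T (\<lambda>t. g (\<gamma> t) (pd U \<phi> (\<gamma> t) (axis j 1)) (E i (\<gamma> t)))" for j
    unfolding T_def
    by (rule smooth_curve_compose[OF \<gamma> oU g_smooth[OF oU smooth_vector_field_pd[OF ch]
        smooth_vector_field_subset[OF E_smooth]]]) simp
  ultimately have "smooth_on T (\<lambda>t. \<Sum>j\<in>UNIV. V t (\<lambda>q. \<phi> q $ j)
      * g (\<gamma> t) (pd U \<phi> (\<gamma> t) (axis j 1)) (E i (\<gamma> t)))"
    by (intro smooth_on_sum[OF o] smooth_on_mult[OF o])
  then have "smooth_on T (\<lambda>t. frame_comp (\<gamma> t) (V t) $ i)"
  proof (rule smooth_on_cong[OF o])
    fix t assume t: "t \<in> T"
    then have cht: "(U, \<phi>) \<in> A" "\<gamma> t \<in> U" using ch by (auto simp: T_def)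
    have Vt: "V t \<in> tangent_space A (\<gamma> t)"
      using V t unfolding T_def smooth_vector_field_along_def by blast
    have "V t = (\<lambda>f. \<Sum>j\<in>UNIV. V t (\<lambda>q. \<phi> q $ j) * pd U \<phi> (\<gamma> t) (axis j 1) f)"
    proof
      fix f
      have l: "linear (\<lambda>w. pd U \<phi> (\<gamma> t) w f)" by (rule pd_linear[OF cht])
      have "V t f = pd U \<phi> (\<gamma> t) (\<Sum>j\<in>UNIV. chart_components \<phi> (V t) $ j *\<^sub>R axis j 1) f"
        using tangent_eq_pd[OF cht Vt]
        by (simp add: basis_expansion[of "chart_components \<phi> (V t)", unfolded scalar_mult_eq_scaleR])
      then show "V t f = (\<Sum>j\<in>UNIV. V t (\<lambda>q. \<phi> q $ j) * pd U \<phi> (\<gamma> t) (axis j 1) f)"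
        by (simp add: linear_sum[OF l] linear_scale[OF l] chart_components_def)
    qed
    then have "g (\<gamma> t) (V t) (E i (\<gamma> t))
        = g (\<gamma> t) (\<lambda>f. \<Sum>j\<in>UNIV. V t (\<lambda>q. \<phi> q $ j) * pd U \<phi> (\<gamma> t) (axis j 1) f) (E i (\<gamma> t))"
      by (rule arg_cong)
    also have "\<dots> = (\<Sum>j\<in>UNIV. V t (\<lambda>q. \<phi> q $ j) * g (\<gamma> t) (pd U \<phi> (\<gamma> t) (axis j 1)) (E i (\<gamma> t)))"
      by (rule g_sum_left[OF finite _ E_tangent]) (simp add: tangent_space_eq[OF cht])
    finally show "(\<Sum>j\<in>UNIV. V t (\<lambda>q. \<phi> q $ j) * g (\<gamma> t) (pd U \<phi> (\<gamma> t) (axis j 1)) (E i (\<gamma> t)))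
        = frame_comp (\<gamma> t) (V t) $ i"
      by (simp add: frame_comp_def)
  qed
  then show "\<exists>T. open T \<and> t0 \<in> T \<and> smooth_on T (\<lambda>t. frame_comp (\<gamma> t) (V t) $ i)"
    using o U \<open>t0 \<in> I\<close> by (auto simp: T_def)
qed

lemma frame_vec_smooth_along:
  assumes "smooth_curve A I \<gamma>" "\<And>i. smooth_on I (\<lambda>t. a t $ i)"
  shows "smooth_vector_field_along A I \<gamma> (\<lambda>t. frame_vec (\<gamma> t) (a t))"
  unfolding frame_vec_def
  by (rule smooth_vector_field_along_sum[OF assms(1)])
     (use assms smooth_vector_field_along_restrict[OF assms(1) E_smooth] in auto)

text \<open>This is the value that additivity and the Leibniz rule force on a combination of the
  restricted frame fields. It serves as the witness for existence and as the common value in the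
  uniqueness argument.\<close>

definition cov :: "(real \<Rightarrow> 'a) \<Rightarrow> (real \<Rightarrow> 'a tangent) \<Rightarrow> real \<Rightarrow> 'a tangent" where
  "cov \<gamma> V t = (\<lambda>f. \<Sum>i\<in>UNIV. deriv (\<lambda>s. frame_comp (\<gamma> s) (V s) $ i) t * E i (\<gamma> t) f
     + frame_comp (\<gamma> t) (V t) $ i * nabla (\<gamma> t) (velocity A \<gamma> t) (E i) f)"

lemma cov_frame_vec:
  assumes "smooth_curve A I \<gamma>" "t \<in> I"
  shows "cov \<gamma> V t = frame_vec (\<gamma> t) (\<chi> k. deriv (\<lambda>s. frame_comp (\<gamma> s) (V s) $ k) t
    + (\<Sum>j\<in>UNIV. \<Sum>i\<in>UNIV. frame_comp (\<gamma> t) (V t) $ j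
         * frame_comp (\<gamma> t) (velocity A \<gamma> t) $ i * \<Gamma> i j k (\<gamma> t)))"
proof -
  define v where "v = frame_comp (\<gamma> t) (velocity A \<gamma> t)"
  have "velocity A \<gamma> t = frame_vec (\<gamma> t) v"
    unfolding v_def by (rule tangent_eq_frame_vec[OF velocity_in_tangent_space[OF assms]])
  then show ?thesis
    unfolding cov_def v_def[symmetric]
    by (simp add: nabla_frame_vec) (simp add: frame_vec_def fun_eq_iff sum_3 algebra_simps)
qed

text \<open>Additivity and the Leibniz rule are inherited from ordinary differentiation of the
  components. Agreement with \<open>nabla\<close> holds because a global field is a combination of
  the frame with smooth coefficients, on which the rules for \<open>nabla\<close> give the same
  formula.\<close>

lemma is_covariant_derivative_cov:
  assumes \<gamma>: "smooth_curve A I \<gamma>"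
  shows "is_covariant_derivative_along A nabla I \<gamma> (cov \<gamma>)"
  unfolding is_covariant_derivative_along_def
proof (intro conjI allI impI ballI)
  have I: "open I" using \<gamma> unfolding smooth_curve_def open_interval_def by blast
  note v = frame_comp_smooth_along[OF \<gamma>]
  note dv = smooth_on_deriv[OF I v]
  have \<Gamma>: "smooth_on I (\<lambda>t. \<Gamma> i j k (\<gamma> t))" for i j k
    using smooth_curve_compose[OF \<gamma> open_UNIV \<Gamma>_smooth] by simp
  have tan: "V t \<in> tangent_space A (\<gamma> t)" if "smooth_vector_field_along A I \<gamma> V" "t \<in> I" for V t
    using that unfolding smooth_vector_field_along_def by blast
  note vel = smooth_vector_field_along_velocity[OF \<gamma>]
  {
    fix V assume V: "smooth_vector_field_along A I \<gamma> V"
    have "smooth_vector_field_along A I \<gamma> (\<lambda>t. frame_vec (\<gamma> t)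
      (\<chi> k. deriv (\<lambda>s. frame_comp (\<gamma> s) (V s) $ k) t
    + (\<Sum>j\<in>UNIV. \<Sum>i\<in>UNIV. frame_comp (\<gamma> t) (V t) $ j
         * frame_comp (\<gamma> t) (velocity A \<gamma> t) $ i * \<Gamma> i j k (\<gamma> t))))" (is "smooth_vector_field_along A I \<gamma> ?W")
      by (rule frame_vec_smooth_along[OF \<gamma>], simp only: vec_lambda_beta,
          intro smooth_on_add[OF I] smooth_on_sum[OF I] smooth_on_mult[OF I]
            dv(1) v \<Gamma> V vel)
    moreover have "smooth_on (I \<inter> \<gamma> -` W) (\<lambda>t. cov \<gamma> V t f)"
      if "smooth_on (I \<inter> \<gamma> -` W) (\<lambda>t. ?W t f)" "open W" for W f
      by (rule smooth_on_cong[OF smooth_curve_open[OF \<gamma> that(2)] that(1)])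
         (use cov_frame_vec[OF \<gamma>] in auto)
    ultimately show "smooth_vector_field_along A I \<gamma> (cov \<gamma> V)"
      unfolding smooth_vector_field_along_def using cov_frame_vec[OF \<gamma>] by (simp add: frame_vec_tangent)
  next
    fix V W t assume VW: "smooth_vector_field_along A I \<gamma> V \<and> smooth_vector_field_along A I \<gamma> W"
      and t: "t \<in> I"
    have eq: "frame_comp (\<gamma> s) (\<lambda>f. V s f + W s f) $ i
        = frame_comp (\<gamma> s) (V s) $ i + frame_comp (\<gamma> s) (W s) $ i" if "s \<in> I" for s i
      unfolding frame_comp_def using VW that by (simp add: g_add_left E_tangent tan)
    have d: "((\<lambda>s. frame_comp (\<gamma> s) (\<lambda>f. V s f + W s f) $ i) has_real_derivative
        deriv (\<lambda>s. frame_comp (\<gamma> s) (V s) $ i) t + deriv (\<lambda>s. frame_comp (\<gamma> s) (W s) $ i) t) (at t)" for i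
      by (rule has_field_derivative_transform_within_open[OF DERIV_add[OF dv(2) dv(2)] I t])
         (use VW t eq in auto)
    then show "cov \<gamma> (\<lambda>s f. V s f + W s f) t = (\<lambda>f. cov \<gamma> V t f + cov \<gamma> W t f)"
      unfolding cov_def by (simp add: DERIV_imp_deriv[OF d] eq[OF t] fun_eq_iff sum.distrib algebra_simps)
  next
    fix a :: "real \<Rightarrow> real" and V t assume aV: "smooth_on I a \<and> smooth_vector_field_along A I \<gamma> V" and t: "t \<in> I"
    have eq: "frame_comp (\<gamma> s) (\<lambda>f. a s * V s f) $ i = a s * frame_comp (\<gamma> s) (V s) $ i" if "s \<in> I" for s i
      unfolding frame_comp_def using aV that by (simp add: g_scale_left E_tangent tan)
    have d: "((\<lambda>s. frame_comp (\<gamma> s) (\<lambda>f. a s * V s f) $ i) has_real_derivative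
        deriv a t * frame_comp (\<gamma> t) (V t) $ i + deriv (\<lambda>s. frame_comp (\<gamma> s) (V s) $ i) t * a t) (at t)" for i
      by (rule has_field_derivative_transform_within_open[OF DERIV_mult[OF smooth_on_deriv(2)[OF I] dv(2)] I t])
         (use aV t eq in auto)
    then have "cov \<gamma> (\<lambda>s f. a s * V s f) t
        = (\<lambda>f. deriv a t * frame_vec (\<gamma> t) (frame_comp (\<gamma> t) (V t)) f + a t * cov \<gamma> V t f)"
      unfolding cov_def
      by (simp add: DERIV_imp_deriv[OF d] eq[OF t] fun_eq_iff sum.distrib sum_distrib_left algebra_simps frame_vec_def)
    then show "cov \<gamma> (\<lambda>s f. a s * V s f) t = (\<lambda>f. deriv a t * V t f + a t * cov \<gamma> V t f)"
      using tangent_eq_frame_vec[OF tan] aV t by metis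
  next
    fix Y t assume Y: "smooth_vector_field A UNIV Y" and t: "t \<in> I"
    define y where "y = (\<lambda>i p. frame_comp p (Y p) $ i)"
    have y: "smooth_fun A UNIV (y i)" for i
      unfolding y_def by (rule smooth_vector_field_frame_comp[OF Y])
    have "Y p \<in> tangent_space A p" for p using Y unfolding smooth_vector_field_def by blast
    from tangent_eq_frame_vec[OF this] have "Y p f = (y 1 p * E 1 p f + y 2 p * E 2 p f) + y 3 p * E 3 p f" for p f
      unfolding frame_vec_def sum_3 y_def by metis
    \<comment> \<open>\<open>nabla\<close> takes a whole field as argument and is additive in two
      fields, so \<open>Y\<close> itself is rewritten as a nested binary sum rather than evaluated
      at a point.\<close>
    then have Y_eq: "Y = (\<lambda>p f. (y 1 p * E 1 p f + y 2 p * E 2 p f) + y 3 p * E 3 p f)" by blast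
    have yE: "smooth_vector_field A UNIV (\<lambda>p f. y i p * E i p f)" for i
      using smooth_vector_field_sum[OF open_UNIV, of "{i}" y E] y E_smooth by simp
    have yEE: "smooth_vector_field A UNIV (\<lambda>p f. y 1 p * E 1 p f + y 2 p * E 2 p f)"
      using smooth_vector_field_sum[OF open_UNIV, of "{1, 2}" y E] y E_smooth by simp
    note vt = velocity_in_tangent_space[OF \<gamma> t]
    have "nabla (\<gamma> t) (velocity A \<gamma> t) Y = (\<lambda>f. \<Sum>i\<in>UNIV. velocity A \<gamma> t (y i) * E i (\<gamma> t) f
        + y i (\<gamma> t) * nabla (\<gamma> t) (velocity A \<gamma> t) (E i) f)"
      by (subst Y_eq, subst nabla_add[OF yEE yE vt], subst nabla_add[OF yE yE vt])
         (simp add: nabla_leibniz[OF y E_smooth vt] sum_3)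
    moreover have "velocity A \<gamma> t (y i) = deriv (\<lambda>s. frame_comp (\<gamma> s) (Y (\<gamma> s)) $ i) t" for i
      using velocity_apply(2)[OF \<gamma> t open_UNIV _ y] by (simp add: y_def)
    ultimately show "cov \<gamma> (\<lambda>s. Y (\<gamma> s)) t = nabla (\<gamma> t) (velocity A \<gamma> t) Y"
      by (simp add: cov_def y_def)
  }
qed

lemma covariant_derivative_along_spec:
  assumes "smooth_curve A I \<gamma>"
  shows "is_covariant_derivative_along A nabla I \<gamma> (covariant_derivative_along A nabla I \<gamma>)"
  unfolding covariant_derivative_along_def
  by (rule someI[of "is_covariant_derivative_along A nabla I \<gamma>", OF is_covariant_derivative_cov[OF assms]])

lemma covariant_derivative_along_restrict:
  assumes "smooth_curve A I \<gamma>" "t \<in> I" "smooth_vector_field A UNIV Y"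
  shows "covariant_derivative_along A nabla I \<gamma> (\<lambda>s. Y (\<gamma> s)) t = nabla (\<gamma> t) (velocity A \<gamma> t) Y"
  using covariant_derivative_along_spec[OF assms(1)] assms(2,3)
  unfolding is_covariant_derivative_along_def by blast

text \<open>The indicator function of \<open>I\<close> makes the values of \<open>V\<close> outside \<open>I\<close> irrelevant, so that \<open>V\<close>
  may be replaced by its expansion in the frame.\<close>

lemma covariant_derivative_along_unique:
  assumes \<gamma>: "smooth_curve A I \<gamma>" and t: "t \<in> I" and V: "smooth_vector_field_along A I \<gamma> V"
    and D: "is_covariant_derivative_along A nabla I \<gamma> D"
  shows "D V t = cov \<gamma> V t"
proof -
  have I: "open I" using \<gamma> unfolding smooth_curve_def open_interval_def by blast
  define b where "b = (indicator I :: real \<Rightarrow> real)"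
  define v where "v = (\<lambda>i s. b s * frame_comp (\<gamma> s) (V s) $ i)"
  have b: "smooth_on I b"
    by (rule smooth_on_cong[OF I smooth_on_const[of I 1]]) (simp add: b_def)
  have db: "deriv b t = 0"
    by (rule DERIV_imp_deriv, rule has_field_derivative_transform_within_open[OF DERIV_const I t])
       (simp add: b_def)
  have v: "smooth_on I (v i)" for i
    unfolding v_def by (rule smooth_on_mult[OF I b frame_comp_smooth_along[OF \<gamma> V]])
  have vt: "v i t = frame_comp (\<gamma> t) (V t) $ i" for i using t by (simp add: v_def b_def)
  have dv: "deriv (v i) t = deriv (\<lambda>s. frame_comp (\<gamma> s) (V s) $ i) t" for i
  proof (rule DERIV_imp_deriv, rule has_field_derivative_transform_within_open[OF _ I t])
    show "((\<lambda>s. frame_comp (\<gamma> s) (V s) $ i) has_real_derivative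
        deriv (\<lambda>s. frame_comp (\<gamma> s) (V s) $ i) t) (at t)"
      by (rule smooth_on_deriv(2)[OF I frame_comp_smooth_along[OF \<gamma> V] t])
  qed (simp add: v_def b_def)
  have Dadd: "D (\<lambda>s f. V s f + W s f) t = (\<lambda>f. D V t f + D W t f)"
    if "smooth_vector_field_along A I \<gamma> V" "smooth_vector_field_along A I \<gamma> W" for V W
    using D that t unfolding is_covariant_derivative_along_def by blast
  have Dmult: "D (\<lambda>s f. a s * V s f) t = (\<lambda>f. deriv a t * V t f + a t * D V t f)"
    if "smooth_on I a" "smooth_vector_field_along A I \<gamma> V" for a V
    using D that t unfolding is_covariant_derivative_along_def by blast
  have DE: "D (\<lambda>s. E i (\<gamma> s)) t = nabla (\<gamma> t) (velocity A \<gamma> t) (E i)" for i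
    using D E_smooth t unfolding is_covariant_derivative_along_def by blast
  note Es = smooth_vector_field_along_restrict[OF \<gamma> E_smooth]
  have vE: "smooth_vector_field_along A I \<gamma> (\<lambda>s f. v i s * E i (\<gamma> s) f)" for i
    using smooth_vector_field_along_sum[OF \<gamma>, of "{i}" v "\<lambda>i s. E i (\<gamma> s)"] v Es by simp
  have vEE: "smooth_vector_field_along A I \<gamma> (\<lambda>s f. v 1 s * E 1 (\<gamma> s) f + v 2 s * E 2 (\<gamma> s) f)"
    using smooth_vector_field_along_sum[OF \<gamma>, of "{1, 2}" v "\<lambda>i s. E i (\<gamma> s)"] v Es by simp
  have bV: "b s * V s f = (v 1 s * E 1 (\<gamma> s) f + v 2 s * E 2 (\<gamma> s) f) + v 3 s * E 3 (\<gamma> s) f" for s f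
  proof (cases "s \<in> I")
    case True
    then have "V s \<in> tangent_space A (\<gamma> s)" using V unfolding smooth_vector_field_along_def by blast
    from fun_cong[OF tangent_eq_frame_vec[OF this], of f] True show ?thesis
      by (simp add: v_def b_def frame_vec_def sum_3)
  qed (simp add: v_def b_def)
  \<comment> \<open>Near \<open>t\<close> the factor \<open>b\<close> is 1 with derivative 0, so by
    the Leibniz rule it does not change the value at \<open>t\<close>. With this factor the field
    equals its frame expansion at every real parameter, as needed to substitute inside
    \<open>D\<close>.\<close>
  have "D V t = D (\<lambda>s f. b s * V s f) t"
    using Dmult[OF b V] db t by (simp add: b_def)
  also have "\<dots> = (\<lambda>f. \<Sum>i\<in>UNIV. deriv (v i) t * E i (\<gamma> t) f
        + v i t * nabla (\<gamma> t) (velocity A \<gamma> t) (E i) f)"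
    unfolding bV by (subst Dadd[OF vEE vE], subst Dadd[OF vE vE])
      (simp add: Dmult[OF v Es] DE sum_3)
  also have "\<dots> = cov \<gamma> V t"
    using t by (simp add: cov_def dv vt)
  finally show ?thesis .
qed

lemmas covariant_derivative_along_eq =
  covariant_derivative_along_unique[OF _ _ _ covariant_derivative_along_spec]

text \<open>Only the values of \<open>a\<close> on the open set \<open>I\<close> enter, as
  derivatives are local. The criterion thus serves both for components found by solving the
  differential equation and for the components of a given velocity.\<close>

lemma arc_length_geodesic_iff:
  assumes \<gamma>: "smooth_curve A I \<gamma>" and a: "\<And>t. t \<in> I \<Longrightarrow> velocity A \<gamma> t = frame_vec (\<gamma> t) (a t)"
  shows "arc_length_geodesic A g nabla I \<gamma> \<longleftrightarrow>
    (\<forall>t\<in>I. (\<forall>k. deriv (\<lambda>s. a s $ k) t = - (\<Sum>j\<in>UNIV. \<Sum>i\<in>UNIV. a t $ j * a t $ i * \<Gamma> i j k (\<gamma> t))) \<and>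
       a t \<bullet> a t = 1)"
proof -
  have I: "open I" using \<gamma> unfolding smooth_curve_def open_interval_def by blast
  note vel = smooth_vector_field_along_velocity[OF \<gamma>]
  have "covariant_derivative_along A nabla I \<gamma> (velocity A \<gamma>) t = (\<lambda>f. 0) \<longleftrightarrow>
    (\<forall>k. deriv (\<lambda>s. a s $ k) t = - (\<Sum>j\<in>UNIV. \<Sum>i\<in>UNIV. a t $ j * a t $ i * \<Gamma> i j k (\<gamma> t)))"
    if t: "t \<in> I" for t
  proof -
    have d: "deriv (\<lambda>s. frame_comp (\<gamma> s) (velocity A \<gamma> s) $ k) t = deriv (\<lambda>s. a s $ k) t" for k
      by (rule deriv_cong_ev) (use eventually_nhds_in_open[OF I t] a in \<open>auto elim!: eventually_mono\<close>)
    show ?thesis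
      unfolding covariant_derivative_along_eq[OF \<gamma> t vel \<gamma>] cov_frame_vec[OF \<gamma> t] d
        frame_vec_zero[of "\<gamma> t", symmetric] frame_vec_inject
      by (simp add: vec_eq_iff a[OF t] eq_neg_iff_add_eq_0)
  qed
  then show ?thesis
    unfolding arc_length_geodesic_def using \<gamma> a by (auto simp: g_frame_vec)
qed

end


section \<open>Existence of geodesics\<close>

context framed_manifold
begin

lemma chart_components_frame_vec:
  "chart_components \<phi> (frame_vec p a) = (\<Sum>i\<in>UNIV. a $ i *\<^sub>R chart_components \<phi> (E i p))"
  unfolding frame_vec_def chart_components_sum ..

lemma E_coordinate_smooth:
  assumes "(U, \<phi>) \<in> A"
  shows "smooth_fun A U (\<lambda>p. chart_components \<phi> (E i p) $ j)"
  using E_smooth[of i] smooth_fun_coordinate[OF assms] chart_homeomorphism(1)[OF assms]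
  unfolding smooth_vector_field_def by (simp add: chart_components_def)

text \<open>The coefficient product is symmetric in \<open>j\<close> and \<open>k\<close> while
  \<Gamma> is skew in them. Up to the factor -2 this is the derivative of the squared speed, so
  solutions of the geodesic system have constant speed.\<close>

lemma \<Gamma>_cubic_zero:
  "(\<Sum>k\<in>UNIV. a $ k * (\<Sum>j\<in>UNIV. \<Sum>i\<in>UNIV. a $ j * a $ i * \<Gamma> i j k p)) = 0"
  unfolding sum_3
  by (simp add: \<Gamma>_antisym[of _ 2 1 p] \<Gamma>_antisym[of _ 3 1 p] \<Gamma>_antisym[of _ 3 2 p] algebra_simps)

text \<open>The unknowns are the point in chart coordinates and the velocity in frame components.
  With frame components instead of coordinate velocities, the coefficients of the system are the
  \<Gamma> of the orthonormal frame.\<close>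

lemma geodesic_exists:
  assumes w: "w \<bullet> w = 1"
  obtains I \<gamma> where "arc_length_geodesic A g nabla I \<gamma>" "0 \<in> I" "\<gamma> 0 = p"
    "velocity A \<gamma> 0 = frame_vec p w"
proof -
  obtain U \<phi> where ch: "(U, \<phi>) \<in> A" "p \<in> U" by (rule chart_at)
  define T where "T = (\<phi> ` U) \<times> (UNIV :: (real^3) set)"
  define \<xi> where "\<xi> = (\<lambda>i x. chart_components \<phi> (E i (inv_into U \<phi> x)))"
  \<comment> \<open>\<open>F1\<close> says that the curve has velocity with frame components
    \<open>snd z\<close>, converted to the chart by \<xi>; \<open>F2\<close> is the geodesic
    equation for these components.\<close>
  define F1 where "F1 = (\<lambda>z. \<Sum>i\<in>UNIV. snd z $ i *\<^sub>R \<xi> i (fst z))"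
  define F2 where "F2 = (\<lambda>z :: (real^3) \<times> (real^3). \<chi> k. - (\<Sum>j\<in>UNIV. \<Sum>i\<in>UNIV.
    snd z $ j * snd z $ i * \<Gamma> i j k (inv_into U \<phi> (fst z))))"
  have oU: "open (\<phi> ` U)" using chart_homeomorphism(2)[OF ch(1)] .
  then have oT: "open T" unfolding T_def by (intro open_Times open_UNIV)
  have lift: "smooth_on T (\<lambda>z. h (fst z))" if "smooth_on (\<phi> ` U) h" for h :: "real^3 \<Rightarrow> 'x::real_normed_vector"
    by (rule smooth_on_compose[OF oT oU smooth_on_bounded_linear[OF bounded_linear_fst] that])
       (auto simp: T_def)
  have sU: "smooth_on (\<phi> ` U) (\<lambda>x. f (inv_into U \<phi> x))" if "smooth_fun A U f" for f
    using smooth_fun_chart[OF that ch(1)] by simp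
  have \<xi>: "smooth_on T (\<lambda>z. \<xi> i (fst z))" for i
    unfolding \<xi>_def
    by (rule lift, rule smooth_on_vec_lambda[OF oU], rule sU[OF E_coordinate_smooth[OF ch(1)]])
  have \<Gamma>T: "smooth_on T (\<lambda>z. \<Gamma> i j k (inv_into U \<phi> (fst z)))" for i j k
    by (rule lift[OF sU[OF smooth_fun_subset[OF \<Gamma>_smooth]]]) simp
  have snd_T: "smooth_on T (\<lambda>z. snd z $ i)" for i
    by (rule smooth_on_vec_nth[OF oT smooth_on_bounded_linear[OF bounded_linear_snd]])
  have "smooth_on T F1"
    unfolding F1_def by (intro smooth_on_sum[OF oT] smooth_on_scaleR[OF oT] snd_T \<xi>)
  moreover have "smooth_on T F2"
  proof (rule smooth_on_vec_lambda[OF oT])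
    fix k
    have "smooth_on T (\<lambda>z. - 1 * (\<Sum>j\<in>UNIV. \<Sum>i\<in>UNIV.
        snd z $ j * snd z $ i * \<Gamma> i j k (inv_into U \<phi> (fst z))))"
      by (intro smooth_on_mult[OF oT] smooth_on_sum[OF oT] smooth_on_const snd_T \<Gamma>T)
    then show "smooth_on T (\<lambda>z. F2 z $ k)" by (simp add: F2_def)
  qed
  ultimately have F: "smooth_on T (\<lambda>z. (F1 z, F2 z))" by (rule smooth_on_Pair[OF oT])
  have "(\<phi> p, w) \<in> T" using ch by (simp add: T_def)
  from integral_curve_exists[OF oT this F] obtain d y where d: "d > 0" and y0: "y 0 = (\<phi> p, w)"
    and yT: "\<And>t. t \<in> {-d<..<d} \<Longrightarrow> y t \<in> T"
    and dy: "\<And>t. t \<in> {-d<..<d} \<Longrightarrow> (y has_vector_derivative (F1 (y t), F2 (y t))) (at t)"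
    by metis
  define I where "I = {-d<..<d}"
  have oI: "open I" by (simp add: I_def)
  have y: "smooth_on I y"
    by (rule smooth_on_integral_curve[OF oI oT F]) (use yT dy in \<open>auto simp: I_def\<close>)
  define x where "x = (\<lambda>t. fst (y t))"
  define a where "a = (\<lambda>t. snd (y t))"
  define \<gamma> where "\<gamma> = (\<lambda>t. inv_into U \<phi> (x t))"
  have I: "open_interval I" "0 \<in> I" using d by (auto simp: I_def open_interval_def)
  have x: "smooth_on I x"
    unfolding x_def by (rule smooth_on_linear_comp[OF oI bounded_linear_fst y])
  have dx: "(x has_vector_derivative F1 (y t)) (at t)" if "t \<in> I" for t
    using bounded_linear.has_vector_derivative[OF bounded_linear_fst dy] that
    by (simp add: x_def I_def)
  have da: "((\<lambda>s. a s $ k) has_real_derivative F2 (y t) $ k) (at t)" if "t \<in> I" for t k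
    using bounded_linear.has_vector_derivative[OF
        bounded_linear_compose[OF bounded_linear_vec_nth bounded_linear_snd] dy] that
    by (simp add: a_def I_def has_real_derivative_iff_has_vector_derivative)
  have xU: "x t \<in> \<phi> ` U" if "t \<in> I" for t
    using yT[of t] that by (auto simp: T_def x_def I_def)
  have \<gamma>U: "\<gamma> t \<in> U" if "t \<in> I" for t
    using xU[OF that] by (simp add: \<gamma>_def inv_into_into)
  have \<gamma>: "smooth_curve A I \<gamma>"
    unfolding \<gamma>_def by (rule smooth_curve_chartI[OF ch(1) I(1) x xU])
  have vel: "velocity A \<gamma> t = frame_vec (\<gamma> t) (a t)" if t: "t \<in> I" for t
  proof -
    have "velocity A \<gamma> t = pd U \<phi> (\<gamma> t) (F1 (y t))"
      using velocity_chart_curve[OF ch(1) I(1) x xU t dx[OF t]] by (simp add: \<gamma>_def)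
    also have "F1 (y t) = chart_components \<phi> (frame_vec (\<gamma> t) (a t))"
      by (simp add: chart_components_frame_vec F1_def \<xi>_def \<gamma>_def x_def a_def)
    finally show ?thesis
      using tangent_eq_pd[OF ch(1) \<gamma>U[OF t] frame_vec_tangent] by simp
  qed
  have F2: "F2 (y t) $ k = - (\<Sum>j\<in>UNIV. \<Sum>i\<in>UNIV. a t $ j * a t $ i * \<Gamma> i j k (\<gamma> t))" for t k
    by (simp add: F2_def a_def \<gamma>_def x_def)
  have "((\<lambda>s. a s \<bullet> a s) has_real_derivative 0) (at t)" if t: "t \<in> I" for t
  proof -
    have "((\<lambda>s. \<Sum>k\<in>UNIV. a s $ k * a s $ k) has_real_derivative
        (\<Sum>k\<in>UNIV. F2 (y t) $ k * a t $ k + F2 (y t) $ k * a t $ k)) (at t)"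
      by (intro DERIV_sum DERIV_mult da t)
    moreover have "(\<Sum>k\<in>UNIV. F2 (y t) $ k * a t $ k + F2 (y t) $ k * a t $ k) = 0"
    proof -
      have "F2 (y t) $ k * a t $ k + F2 (y t) $ k * a t $ k = (- 2) * (a t $ k *
          (\<Sum>j\<in>UNIV. \<Sum>i\<in>UNIV. a t $ j * a t $ i * \<Gamma> i j k (\<gamma> t)))" for k
        unfolding F2 by algebra
      then show ?thesis by (simp only: sum_distrib_left[symmetric] \<Gamma>_cubic_zero mult_zero_right)
    qed
    ultimately show ?thesis by (simp add: inner_vec_def)
  qed
  \<comment> \<open>The squared speed is constant on the interval, and its value at time 0 is that
    of \<open>w\<close>, namely 1.\<close>
  then have "\<exists>c. \<forall>t\<in>I. a t \<bullet> a t = c"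
    by (intro has_field_derivative_zero_constant)
       (auto simp: I_def intro: has_field_derivative_at_within)
  moreover have "a 0 = w" using y0 by (simp add: a_def)
  ultimately have "a t \<bullet> a t = 1" if "t \<in> I" for t
    using w I(2) that by metis
  moreover have "deriv (\<lambda>s. a s $ k) t = F2 (y t) $ k" if "t \<in> I" for k t
    using DERIV_imp_deriv[OF da[OF that]] .
  ultimately have "arc_length_geodesic A g nabla I \<gamma>"
    by (intro iffD2[OF arc_length_geodesic_iff[OF \<gamma> vel]]) (simp_all add: F2)
  moreover have "\<gamma> 0 = p" using y0 ch by (simp add: \<gamma>_def x_def)
  ultimately show ?thesis using that I(2) vel[OF I(2)] \<open>a 0 = w\<close> by metis
qed

end

section \<open>Orientation and cross product\<close>

locale oriented_framed_manifold = framed_manifold +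
  assumes oriented: "oriented_smooth_atlas A" and connected: "connected (UNIV :: 'a set)"
begin

lemma chart_components_change:
  assumes ch: "(U, \<phi>) \<in> A" "p \<in> U" and ch': "(V, \<psi>) \<in> A" "p \<in> V" and v: "v \<in> tangent_space A p"
  shows "chart_components \<psi> v
    = matrix (frechet_derivative (\<lambda>x. \<psi> (inv_into U \<phi> x)) (at (\<phi> p))) *v chart_components \<phi> v"
proof -
  define D where "D = frechet_derivative (\<lambda>x. \<psi> (inv_into U \<phi> x)) (at (\<phi> p))"
  have D: "((\<lambda>x. \<psi> (inv_into U \<phi> x)) has_derivative D) (at (\<phi> p))"
    unfolding D_def by (rule smooth_on_has_derivative[OF smooth_on_transition[OF ch(1) ch'(1)]])
      (use ch ch' in auto)
  have "pd U \<phi> p w (\<lambda>q. \<psi> q $ i) = D w $ i" for w i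
  proof -
    have n: "smooth_near A p (\<lambda>q. \<psi> q $ i)"
      by (rule smooth_nearI[OF chart_homeomorphism(1)[OF ch'(1)] ch'(2) smooth_fun_coordinate[OF ch'(1)]])
    have "((\<lambda>x. \<psi> (inv_into U \<phi> x) $ i) has_derivative (\<lambda>w. D w $ i)) (at (\<phi> p))"
      by (rule bounded_linear.has_derivative[OF bounded_linear_vec_nth D])
    from has_derivative_unique[OF this smooth_near_has_derivative[OF ch n]]
    show ?thesis by metis
  qed
  then have "chart_components \<psi> (pd U \<phi> p w) = D w" for w
    by (simp add: chart_components_def vec_eq_iff)
  moreover have "D w = matrix D *v w" for w
    by (metis matrix_vector_mul(2)[OF has_derivative_linear[OF D]])
  ultimately show ?thesis using tangent_eq_pd[OF ch v] unfolding D_def by metis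
qed

definition frame_det :: "('a \<Rightarrow> real^3) \<Rightarrow> 'a \<Rightarrow> real" where
  "frame_det \<phi> p = det (\<chi> i. chart_components \<phi> (E i p))"

text \<open>The factor is the Jacobian determinant of the transition map, positive for an oriented
  atlas. Hence the sign of \<open>frame_det\<close> does not depend on the chart.\<close>

lemma frame_det_change:
  assumes ch: "(U, \<phi>) \<in> A" "p \<in> U" and ch': "(V, \<psi>) \<in> A" "p \<in> V"
  shows "\<exists>c>0. frame_det \<psi> p = c * frame_det \<phi> p"
proof (intro exI conjI)
  let ?J = "matrix (frechet_derivative (\<lambda>x. \<psi> (inv_into U \<phi> x)) (at (\<phi> p)))"
  have "\<phi> p \<in> \<phi> ` (U \<inter> V)" using ch ch' by blast
  then show "det ?J > 0"
    using oriented ch ch' unfolding oriented_smooth_atlas_def comp_def by fast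
  \<comment> \<open>The frame vectors are the rows of the matrix, so the Jacobian acts from the
    right and transposed.\<close>
  have "(\<chi> i. chart_components \<psi> (E i p)) = (\<chi> i. chart_components \<phi> (E i p)) ** transpose ?J"
    by (simp add: chart_components_change[OF ch ch' E_tangent] vec_eq_iff matrix_matrix_mult_def
        matrix_vector_mult_def transpose_def mult.commute)
  then show "frame_det \<psi> p = det ?J * frame_det \<phi> p"
    by (simp add: frame_det_def det_mul det_transpose)
qed

text \<open>Passing from frame to chart components multiplies the matrix of rows by the matrix of
  the frame. Orientation thus splits into the standard orientation of the coefficients and the sign
  of the frame.\<close>

lemma det_frame_vecs:
  "det (vector [chart_components \<phi> (frame_vec p a), chart_components \<phi> (frame_vec p b),
     chart_components \<phi> (frame_vec p c)] :: real^3^3) = det (vector [a, b, c] :: real^3^3) * frame_det \<phi> p"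
proof -
  have "(vector [chart_components \<phi> (frame_vec p a), chart_components \<phi> (frame_vec p b),
     chart_components \<phi> (frame_vec p c)] :: real^3^3)
     = vector [a, b, c] ** (\<chi> i. chart_components \<phi> (E i p))"
    by (simp add: vec_eq_iff forall_3 matrix_matrix_mult_def chart_components_frame_vec)
  then show ?thesis by (simp add: det_mul frame_det_def)
qed

text \<open>Chart components determine a tangent vector, and a tangent vector determines its frame
  coefficients, so the matrix of the frame is injective.\<close>

lemma frame_det_nonzero:
  assumes ch: "(U, \<phi>) \<in> A" "p \<in> U"
  shows "frame_det \<phi> p \<noteq> 0"
proof -
  let ?M = "\<chi> i. chart_components \<phi> (E i p)"
  have M: "transpose ?M *v a = chart_components \<phi> (frame_vec p a)" for a
    by (simp add: vec_eq_iff chart_components_frame_vec matrix_vector_mult_def transpose_def mult.commute)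
  have "inj ((*v) (transpose ?M))"
    by (rule injI) (metis M tangent_eq_pd[OF ch frame_vec_tangent] frame_vec_inject)
  then have "det (matrix ((*v) (transpose ?M))) \<noteq> 0"
    by (simp only: det_nz_iff_inj[OF matrix_vector_mul_linear] not_False_eq_True)
  then have "det (transpose ?M) \<noteq> 0" by (simp only: matrix_of_matrix_vector_mul not_False_eq_True)
  then show ?thesis by (metis det_transpose frame_det_def)
qed

lemma frame_det_continuous:
  assumes ch: "(U, \<phi>) \<in> A"
  shows "continuous_on U (frame_det \<phi>)"
proof -
  have "continuous_on U (\<lambda>p. chart_components \<phi> (E i p) $ j)" for i j
    by (rule smooth_fun_continuous[OF chart_homeomorphism(1)[OF ch] E_coordinate_smooth[OF ch]])
  then show ?thesis
    unfolding frame_det_def det_3 vec_lambda_beta by (intro continuous_on_add continuous_on_diff continuous_on_mult)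
qed

text \<open>The points where the frame is positively, respectively negatively, oriented form two
  open sets. They are disjoint because the sign is independent of the chart, and they cover the
  manifold because the determinant never vanishes; connectedness leaves only one of them.\<close>

lemma orientation_sign_exists:
  "\<exists>\<epsilon>::real. \<bar>\<epsilon>\<bar> = 1 \<and> (\<forall>U \<phi> p. (U, \<phi>) \<in> A \<longrightarrow> p \<in> U \<longrightarrow> \<epsilon> * frame_det \<phi> p > 0)"
proof -
  define P where "P = (\<lambda>\<epsilon>::real. {p. \<exists>U \<phi>. (U, \<phi>) \<in> A \<and> p \<in> U \<and> \<epsilon> * frame_det \<phi> p > 0})"
  have oP: "open (P \<epsilon>)" for \<epsilon>
  proof (subst open_subopen, clarify)
    fix p assume "p \<in> P \<epsilon>"
    then obtain U \<phi> where ch: "(U, \<phi>) \<in> A" "p \<in> U" "\<epsilon> * frame_det \<phi> p > 0" unfolding P_def by blast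
    have "continuous_on U (\<lambda>q. \<epsilon> * frame_det \<phi> q)"
      by (intro continuous_intros frame_det_continuous[OF ch(1)])
    then have "open ((\<lambda>q. \<epsilon> * frame_det \<phi> q) -` {0<..} \<inter> U)"
      by (rule continuous_on_open_vimage[THEN iffD1, rule_format, OF chart_homeomorphism(1)[OF ch(1)]]) simp
    moreover have "(\<lambda>q. \<epsilon> * frame_det \<phi> q) -` {0<..} \<inter> U \<subseteq> P \<epsilon>"
      using ch(1) unfolding P_def by auto
    ultimately show "\<exists>T. open T \<and> p \<in> T \<and> T \<subseteq> P \<epsilon>" using ch by blast
  qed
  have P: "\<epsilon> * frame_det \<psi> p > 0" if p: "p \<in> P \<epsilon>" and ch': "(V, \<psi>) \<in> A" "p \<in> V" for \<epsilon> p V \<psi>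
  proof -
    obtain U \<phi> where ch: "(U, \<phi>) \<in> A" "p \<in> U" "\<epsilon> * frame_det \<phi> p > 0" 
      using p unfolding P_def by blast
    then obtain c where "c > 0" "frame_det \<psi> p = c * frame_det \<phi> p"
      using frame_det_change[OF ch(1,2) ch'] by blast
    then show ?thesis
      using ch(3) mult_pos_pos[of c "\<epsilon> * frame_det \<phi> p"] by (simp add: mult.left_commute)
  qed
  have "P 1 \<inter> P (- 1) \<inter> UNIV = {}"
  proof -
    have False if "p \<in> P 1" "p \<in> P (- 1)" for p
    proof -
      obtain U \<phi> where "(U, \<phi>) \<in> A" "p \<in> U" by (rule chart_at)
      then show False using P[OF that(1)] P[OF that(2)] by force
    qed
    then show ?thesis by blast
  qed
  moreover have cover: "UNIV \<subseteq> P 1 \<union> P (- 1)"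
  proof
    fix p
    obtain U \<phi> where ch: "(U, \<phi>) \<in> A" "p \<in> U" by (rule chart_at)
    then have "frame_det \<phi> p > 0 \<or> - frame_det \<phi> p > 0" using frame_det_nonzero[OF ch] by linarith
    then show "p \<in> P 1 \<union> P (- 1)" using ch unfolding P_def by auto
  qed
  ultimately have "P 1 = {} \<or> P (- 1) = {}"
    using connectedD[OF connected oP oP] by (metis inf_top.right_neutral)
  then have "P 1 = UNIV \<or> P (- 1) = UNIV" using cover by auto
  then show ?thesis
  proof
    assume "P 1 = UNIV"
    then show ?thesis using P[of _ 1] by (intro exI[of _ 1]) auto
  next
    assume "P (- 1) = UNIV"
    then show ?thesis using P[of _ "- 1"] by (intro exI[of _ "- 1"]) auto
  qed
qed

definition \<epsilon> :: real where
  "\<epsilon> = (SOME \<epsilon>. \<bar>\<epsilon>\<bar> = 1 \<and> (\<forall>U \<phi> p. (U, \<phi>) \<in> A \<longrightarrow> p \<in> U \<longrightarrow> \<epsilon> * frame_det \<phi> p > 0))"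

lemma \<epsilon>: "\<bar>\<epsilon>\<bar> = 1" "(U, \<phi>) \<in> A \<Longrightarrow> p \<in> U \<Longrightarrow> \<epsilon> * frame_det \<phi> p > 0"
  using someI_ex[OF orientation_sign_exists] unfolding \<epsilon>_def by blast+

lemma \<epsilon>_square: "\<epsilon> * \<epsilon> = 1"
  using \<epsilon>(1) by (metis abs_mult_self_eq mult_1)

lemma positive_triple_iff:
  "positive_triple A p (frame_vec p a) (frame_vec p b) (frame_vec p c)
    \<longleftrightarrow> \<epsilon> * det (vector [a, b, c] :: real^3^3) > 0"
proof -
  have "det (vector [a, b, c] :: real^3^3) * frame_det \<phi> p > 0 \<longleftrightarrow> \<epsilon> * det (vector [a, b, c] :: real^3^3) > 0"
    if "(U, \<phi>) \<in> A" "p \<in> U" for U \<phi>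
    using \<epsilon>(2)[OF that] by (auto simp: zero_less_mult_iff)
  moreover obtain U \<phi> where "(U, \<phi>) \<in> A" "p \<in> U" by (rule chart_at)
  ultimately show ?thesis
    unfolding positive_triple_def det_frame_vecs by fast
qed

text \<open>Put \<open>n = cross3 a b\<close>. Orthogonality to \<open>a\<close> and
  \<open>b\<close> makes \<open>c\<close> parallel to \<open>n\<close> by the triple product
  formula, and the length condition makes their norms equal. The sign condition then decides between
  the two remaining vectors; if \<open>c = 0\<close>, so is \<open>n\<close>.\<close>

lemma cross3_unique:
  fixes a b c :: "real^3"
  assumes "c \<bullet> a = 0" "c \<bullet> b = 0" "c \<bullet> c = (a \<bullet> a) * (b \<bullet> b) - (a \<bullet> b)\<^sup>2"
    and "c \<noteq> 0 \<Longrightarrow> \<epsilon> * (c \<bullet> cross3 a b) > 0"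
  shows "c = \<epsilon> *\<^sub>R cross3 a b"
proof -
  define n where "n = cross3 a b"
  have nn: "n \<bullet> n = c \<bullet> c"
    using norm_cross_dot[of a b] assms(3)
    by (simp add: n_def power2_norm_eq_inner power_mult_distrib algebra_simps)
  have "cross3 c n = 0"
    unfolding n_def using assms(1,2)
    by (simp add: Lagrange)
  then have "(c \<bullet> n)\<^sup>2 = (norm c)\<^sup>2 * (norm n)\<^sup>2"
    using norm_cross_dot[of c n] by (simp add: power_mult_distrib)
  then have sq: "(c \<bullet> n)\<^sup>2 = (c \<bullet> c)\<^sup>2"
    unfolding power2_norm_eq_inner nn by (simp only: power2_eq_square)
  have "\<epsilon> * (c \<bullet> n) = c \<bullet> c"
  proof (cases "c = 0")
    case False
    have "(\<epsilon> * (c \<bullet> n))\<^sup>2 = (\<epsilon> * \<epsilon>) * (c \<bullet> n)\<^sup>2" by (simp add: power2_eq_square)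
    then have "(\<epsilon> * (c \<bullet> n))\<^sup>2 = (c \<bullet> c)\<^sup>2" using sq \<epsilon>_square by simp
    then show ?thesis using assms(4)[OF False] unfolding n_def by simp
  qed simp
  moreover have "(c - \<epsilon> *\<^sub>R n) \<bullet> (c - \<epsilon> *\<^sub>R n) = c \<bullet> c - 2 * (\<epsilon> * (c \<bullet> n)) + (\<epsilon> * \<epsilon>) * (n \<bullet> n)"
    by (simp add: inner_diff_left inner_diff_right inner_commute algebra_simps)
  ultimately have "(c - \<epsilon> *\<^sub>R n) \<bullet> (c - \<epsilon> *\<^sub>R n) = 0" using nn \<epsilon>_square by simp
  then show ?thesis by (simp add: n_def)
qed

text \<open>The definite description is meaningful because its condition has exactly one solution,
  also for dependent arguments, where the solution is 0 and the orientation clause is void.\<close>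

lemma cross_product_frame_vec:
  "cross_product A g p (frame_vec p a) (frame_vec p b) = frame_vec p (\<epsilon> *\<^sub>R cross3 a b)"
proof -
  have det: "det (vector [a, b, c] :: real^3^3) = c \<bullet> cross3 a b" for c
    by (simp add: dot_cross_det[symmetric]) (simp add: cross3_simps)
  have "(w \<in> tangent_space A p \<and> g p w (frame_vec p a) = 0 \<and> g p w (frame_vec p b) = 0 \<and>
     g p w w = g p (frame_vec p a) (frame_vec p a) * g p (frame_vec p b) (frame_vec p b)
       - (g p (frame_vec p a) (frame_vec p b))\<^sup>2 \<and>
     (w \<noteq> (\<lambda>f. 0) \<longrightarrow> positive_triple A p (frame_vec p a) (frame_vec p b) w))
    \<longleftrightarrow> w = frame_vec p (\<epsilon> *\<^sub>R cross3 a b)" (is "?P w \<longleftrightarrow> _") for w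
  proof
    assume P: "?P w"
    then obtain c where c: "w = frame_vec p c" using tangent_eq_frame_vec by blast
    have "c = \<epsilon> *\<^sub>R cross3 a b"
    proof (rule cross3_unique)
      show "\<epsilon> * (c \<bullet> cross3 a b) > 0" if "c \<noteq> 0"
        using P that unfolding c frame_vec_zero[of p, symmetric] frame_vec_inject positive_triple_iff det
        by blast
    qed (use P in \<open>auto simp: c g_frame_vec\<close>)
    then show "w = frame_vec p (\<epsilon> *\<^sub>R cross3 a b)" by (simp add: c)
  next
    assume w: "w = frame_vec p (\<epsilon> *\<^sub>R cross3 a b)"
    have n: "cross3 a b \<bullet> cross3 a b = (a \<bullet> a) * (b \<bullet> b) - (a \<bullet> b)\<^sup>2"
      using norm_cross_dot[of a b]
      by (simp add: power2_norm_eq_inner power_mult_distrib algebra_simps)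
    have e: "\<epsilon> * (\<epsilon> *\<^sub>R cross3 a b \<bullet> cross3 a b) = cross3 a b \<bullet> cross3 a b"
      using \<epsilon>_square by simp
    have pos: "\<epsilon> * (\<epsilon> *\<^sub>R cross3 a b \<bullet> cross3 a b) > 0"
      if "frame_vec p (\<epsilon> *\<^sub>R cross3 a b) \<noteq> (\<lambda>f. 0)"
      unfolding e using that frame_vec_zero by auto
    have "(\<epsilon> *\<^sub>R cross3 a b) \<bullet> (\<epsilon> *\<^sub>R cross3 a b) = cross3 a b \<bullet> cross3 a b"
      using \<epsilon>_square by simp
    then show "?P w"
      unfolding w positive_triple_iff det g_frame_vec
      by (intro conjI impI pos) (simp_all add: frame_vec_tangent n dot_cross_self)
  qed
  then show ?thesis unfolding cross_product_def by simp
qed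

end


section \<open>Tops\<close>

lemma constant_on_imp_deriv_zero:
  fixes f :: "real \<Rightarrow> real"
  assumes "f constant_on I" "open I" "t \<in> I"
  shows "deriv f t = 0"
proof -
  obtain c where "\<And>s. s \<in> I \<Longrightarrow> c = f s" using assms(1) unfolding constant_on_def by metis
  then show ?thesis
    by (intro DERIV_imp_deriv has_field_derivative_transform_within_open[OF DERIV_const assms(2,3)])
qed

context oriented_framed_manifold
begin

text \<open>Only nine of the \<open>\<Gamma> i j k\<close> are independent by \<open>\<Gamma>_antisym\<close>, and the nine components of the
  brackets determine them.\<close>

lemma lie_brackets_iff:
  "lie_bracket A (E 1) (E 2) = (\<lambda>p f. c * E 3 p f) \<and>
   lie_bracket A (E 2) (E 3) = (\<lambda>p f. k * E 1 p f) \<and>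
   lie_bracket A (E 3) (E 1) = (\<lambda>p f. k * E 2 p f) \<longleftrightarrow>
   (\<forall>p. \<Gamma> 1 1 2 p = 0 \<and> \<Gamma> 2 1 2 p = 0 \<and> \<Gamma> 1 1 3 p = 0 \<and> \<Gamma> 2 2 3 p = 0 \<and> \<Gamma> 3 1 3 p = 0 \<and>
        \<Gamma> 3 2 3 p = 0 \<and> \<Gamma> 1 2 3 p = c / 2 \<and> \<Gamma> 2 1 3 p = - c / 2 \<and> \<Gamma> 3 1 2 p = k - c / 2)"
proof -
  have neq: "(1::3) \<noteq> 2" "(1::3) \<noteq> 3" "(2::3) \<noteq> 3" by simp_all
  have "lie_bracket A (E i) (E j) p = (\<lambda>f. b * E l p f) \<longleftrightarrow>
      (\<forall>k. \<Gamma> i j k p - \<Gamma> j i k p = (if k = l then b else 0))" for i j l b p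
  proof -
    have "(\<lambda>f. b * E l p f) = frame_vec p (b *\<^sub>R axis l 1)"
      by (simp add: frame_vec_scaleR frame_vec_axis)
    moreover have "(b *\<^sub>R axis l 1) $ k = (if k = l then b else 0)" for k
      by (simp add: axis_def)
    ultimately show ?thesis by (simp add: lie_bracket_E vec_eq_iff)
  qed
  then have bracket: "lie_bracket A (E i) (E j) = (\<lambda>p f. b * E l p f) \<longleftrightarrow>
      (\<forall>p k. \<Gamma> i j k p - \<Gamma> j i k p = (if k = l then b else 0))" for i j l b
    by (simp add: fun_eq_iff[of "lie_bracket A (E i) (E j)"])
  \<comment> \<open>Three of the nine components read
    \<open>\<Gamma> 1 2 3 - \<Gamma> 2 1 3 = c\<close>,
    \<open>\<Gamma> 3 1 2 - \<Gamma> 2 1 3 = k\<close> and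
    \<open>\<Gamma> 3 1 2 + \<Gamma> 1 2 3 = k\<close>. The equality of the last two right-hand
    sides gives \<open>\<Gamma> 2 1 3 = - \<Gamma> 1 2 3\<close>, whence the value
    \<open>c / 2\<close>. Each of the other six components is a single coefficient up to
    sign.\<close>
  have "(\<forall>l. \<Gamma> 1 2 l p - \<Gamma> 2 1 l p = (if l = 3 then c else 0)) \<and>
    (\<forall>l. \<Gamma> 2 3 l p - \<Gamma> 3 2 l p = (if l = 1 then k else 0)) \<and>
    (\<forall>l. \<Gamma> 3 1 l p - \<Gamma> 1 3 l p = (if l = 2 then k else 0)) \<longleftrightarrow>
    \<Gamma> 1 1 2 p = 0 \<and> \<Gamma> 2 1 2 p = 0 \<and> \<Gamma> 1 1 3 p = 0 \<and> \<Gamma> 2 2 3 p = 0 \<and> \<Gamma> 3 1 3 p = 0 \<and>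
        \<Gamma> 3 2 3 p = 0 \<and> \<Gamma> 1 2 3 p = c / 2 \<and> \<Gamma> 2 1 3 p = - c / 2 \<and> \<Gamma> 3 1 2 p = k - c / 2" for p
    using neq unfolding forall_3
    by (simp add: \<Gamma>_antisym[of _ 2 1 p] \<Gamma>_antisym[of _ 3 1 p] \<Gamma>_antisym[of _ 3 2 p]) linarith
  then show ?thesis unfolding bracket by blast
qed

section \<open>Rotation speeds, transversality and angle in frame components\<close>

context
  fixes I \<gamma> a t
  assumes \<gamma>: "smooth_curve A I \<gamma>" and t: "t \<in> I" and a: "velocity A \<gamma> t = frame_vec (\<gamma> t) a"
begin

lemma rotation_speed_axis:
  "rotation_speed A g nabla I \<gamma> (\<lambda>s. E 3 (\<gamma> s)) (velocity A \<gamma>) t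
   = \<epsilon> * (a $ 2 * (\<Sum>i\<in>UNIV. a $ i * \<Gamma> i 3 1 (\<gamma> t)) - a $ 1 * (\<Sum>i\<in>UNIV. a $ i * \<Gamma> i 3 2 (\<gamma> t)))"
proof -
  \<comment> \<open>In components the standard product of \<open>a\<close> with the third axis is
    \<open>(a $ 2, - a $ 1, 0)\<close>; this produces the two terms of the claim.\<close>
  have "cross_product A g (\<gamma> t) (frame_vec (\<gamma> t) a) (E 3 (\<gamma> t))
      = frame_vec (\<gamma> t) (\<epsilon> *\<^sub>R cross3 a (axis 3 1))"
    unfolding frame_vec_axis[of _ 3, symmetric] cross_product_frame_vec ..
  then show ?thesis
    unfolding rotation_speed_def covariant_derivative_along_restrict[OF \<gamma> t E_smooth] a nabla_frame_vec
    by (simp add: g_frame_vec) (simp add: inner_vec_def sum_3 cross3_def axis_def algebra_simps)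
qed

lemma rotation_speed_about_axis:
  "rotation_speed A g nabla I \<gamma> (\<lambda>s. E 1 (\<gamma> s)) (\<lambda>s. E 3 (\<gamma> s)) t
   = \<epsilon> * (\<Sum>i\<in>UNIV. a $ i * \<Gamma> i 1 2 (\<gamma> t))"
proof -
  have "cross_product A g (\<gamma> t) (E 3 (\<gamma> t)) (E 1 (\<gamma> t))
      = frame_vec (\<gamma> t) (\<epsilon> *\<^sub>R cross3 (axis 3 1) (axis 1 1))"
    unfolding frame_vec_axis[of _ 3, symmetric] frame_vec_axis[of _ 1, symmetric]
      cross_product_frame_vec ..
  then show ?thesis
    unfolding rotation_speed_def covariant_derivative_along_restrict[OF \<gamma> t E_smooth] a nabla_frame_vec
    by (simp add: g_frame_vec) (simp add: inner_vec_def sum_3 cross3_def axis_def algebra_simps)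
qed

lemma velocity_in_axis_bundle_iff:
  "velocity A \<gamma> t \<in> axis_bundle A (\<lambda>p. g p (E 1 p)) (\<lambda>p. g p (E 2 p)) (\<gamma> t) \<longleftrightarrow> a $ 1 = 0 \<and> a $ 2 = 0"
proof -
  have "g (\<gamma> t) (E i (\<gamma> t)) (frame_vec (\<gamma> t) a) = a $ i" for i
    using g_frame_vec[of "\<gamma> t" "axis i 1" a] by (simp add: frame_vec_axis inner_axis' )
  then have "velocity A \<gamma> t \<in> axis_bundle A (\<lambda>p. g p (E 1 p)) (\<lambda>p. g p (E 2 p)) (\<gamma> t) \<longleftrightarrow>
      (\<forall>\<theta>. cos \<theta> * a $ 1 + sin \<theta> * a $ 2 = 0)"
    unfolding axis_bundle_def pencil_plane_def a by (auto simp: frame_vec_tangent)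
  also have "\<dots> \<longleftrightarrow> a $ 1 = 0 \<and> a $ 2 = 0"
  proof
    assume h: "\<forall>\<theta>. cos \<theta> * a $ 1 + sin \<theta> * a $ 2 = 0"
    \<comment> \<open>The angles 0 and pi/2 single out the two defining forms.\<close>
    show "a $ 1 = 0 \<and> a $ 2 = 0" using h[rule_format, of 0] h[rule_format, of "pi / 2"] by simp
  qed simp
  finally show ?thesis .
qed

lemma angle_velocity_axis:
  assumes "a \<bullet> a = 1"
  shows "angle g (\<gamma> t) (velocity A \<gamma> t) (E 3 (\<gamma> t)) = arccos (a $ 3)"
  unfolding angle_def a frame_vec_axis[of _ 3, symmetric] g_frame_vec assms by (simp add: inner_axis)

end

definition vel_comp :: "(real \<Rightarrow> 'a) \<Rightarrow> real \<Rightarrow> real^3" where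
  "vel_comp \<gamma> t = frame_comp (\<gamma> t) (velocity A \<gamma> t)"

lemma velocity_eq_vel_comp:
  "smooth_curve A I \<gamma> \<Longrightarrow> t \<in> I \<Longrightarrow> velocity A \<gamma> t = frame_vec (\<gamma> t) (vel_comp \<gamma> t)"
  unfolding vel_comp_def by (rule tangent_eq_frame_vec[OF velocity_in_tangent_space])

text \<open>The bound on the third component makes arccos invertible there, so statements on the
  angle with \<open>E 3\<close> and statements on this component can be exchanged.\<close>

lemma geodesicD:
  assumes "arc_length_geodesic A g nabla I \<gamma>"
  shows "smooth_curve A I \<gamma>" "open I" "is_interval I"
    and "\<And>t. t \<in> I \<Longrightarrow> vel_comp \<gamma> t \<bullet> vel_comp \<gamma> t = 1"
    and "\<And>t. t \<in> I \<Longrightarrow> \<bar>vel_comp \<gamma> t $ 3\<bar> \<le> 1"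
    and "\<And>t k. t \<in> I \<Longrightarrow> ((\<lambda>s. vel_comp \<gamma> s $ k) has_real_derivative
      - (\<Sum>j\<in>UNIV. \<Sum>i\<in>UNIV. vel_comp \<gamma> t $ j * vel_comp \<gamma> t $ i * \<Gamma> i j k (\<gamma> t))) (at t)"
    and "\<And>t. t \<in> I \<Longrightarrow> angle g (\<gamma> t) (velocity A \<gamma> t) (E 3 (\<gamma> t)) = arccos (vel_comp \<gamma> t $ 3)"
proof -
  show \<gamma>: "smooth_curve A I \<gamma>" using assms unfolding arc_length_geodesic_def by blast
  then show I: "open I" "is_interval I" unfolding smooth_curve_def open_interval_def by auto
  note v = velocity_eq_vel_comp[OF \<gamma>]
  have geo: "\<forall>t\<in>I. (\<forall>k. deriv (\<lambda>s. vel_comp \<gamma> s $ k) t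
      = - (\<Sum>j\<in>UNIV. \<Sum>i\<in>UNIV. vel_comp \<gamma> t $ j * vel_comp \<gamma> t $ i * \<Gamma> i j k (\<gamma> t))) \<and>
       vel_comp \<gamma> t \<bullet> vel_comp \<gamma> t = 1"
    by (rule iffD1[OF arc_length_geodesic_iff[OF \<gamma> v] assms])
  then show n: "vel_comp \<gamma> t \<bullet> vel_comp \<gamma> t = 1" if "t \<in> I" for t using that by blast
  show "\<bar>vel_comp \<gamma> t $ 3\<bar> \<le> 1" if "t \<in> I" for t
    using component_le_norm_cart[of "vel_comp \<gamma> t" 3] n[OF that] by (simp add: norm_eq_sqrt_inner)
  show "((\<lambda>s. vel_comp \<gamma> s $ k) has_real_derivative
      - (\<Sum>j\<in>UNIV. \<Sum>i\<in>UNIV. vel_comp \<gamma> t $ j * vel_comp \<gamma> t $ i * \<Gamma> i j k (\<gamma> t))) (at t)"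
    if t: "t \<in> I" for t k
  proof -
    have "smooth_on I (\<lambda>t. vel_comp \<gamma> t $ k)"
      unfolding vel_comp_def by (rule frame_comp_smooth_along[OF \<gamma> smooth_vector_field_along_velocity[OF \<gamma>]])
    from smooth_on_deriv(2)[OF I(1) this t] show ?thesis by (rule DERIV_cong) (use geo t in blast)
  qed
  show "angle g (\<gamma> t) (velocity A \<gamma> t) (E 3 (\<gamma> t)) = arccos (vel_comp \<gamma> t $ 3)" if "t \<in> I" for t
    by (rule angle_velocity_axis[OF \<gamma> that v[OF that] n[OF that]])
qed

text \<open>With these coefficients the quadratic terms in the equation for the third velocity
  component cancel, so that component is constant along geodesics. The angle and both rotation
  speeds depend on it alone, through formulas with constant coefficients, which gives all four
  conditions.\<close>

lemma lie_brackets_imp_top: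
  assumes "lie_bracket A (E 1) (E 2) = (\<lambda>p f. c * E 3 p f)"
    and "lie_bracket A (E 2) (E 3) = (\<lambda>p f. k * E 1 p f)"
    and "lie_bracket A (E 3) (E 1) = (\<lambda>p f. k * E 2 p f)"
  shows "determines_top A g nabla (E 1) (E 2) (E 3)"
proof -
  have \<Gamma>: "\<Gamma> 1 1 2 p = 0" "\<Gamma> 2 1 2 p = 0" "\<Gamma> 1 1 3 p = 0" "\<Gamma> 2 2 3 p = 0" "\<Gamma> 3 1 3 p = 0"
    "\<Gamma> 3 2 3 p = 0" "\<Gamma> 1 2 3 p = c / 2" "\<Gamma> 2 1 3 p = - c / 2" "\<Gamma> 3 1 2 p = k - c / 2" for p
    using lie_brackets_iff assms by blast+
  note \<Gamma>' = \<Gamma> \<Gamma>_antisym[of _ 2 1] \<Gamma>_antisym[of _ 3 1] \<Gamma>_antisym[of _ 3 2]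
  have const: "\<exists>z. \<forall>t\<in>I. vel_comp \<gamma> t $ 3 = z" if geo: "arc_length_geodesic A g nabla I \<gamma>" for I \<gamma>
  proof (rule has_field_derivative_zero_constant)
    show "convex I" using geodesicD(3)[OF geo] by (simp add: is_interval_convex_1)
    show "((\<lambda>t. vel_comp \<gamma> t $ 3) has_real_derivative 0) (at t within I)" if "t \<in> I" for t
      using geodesicD(6)[OF geo that, of 3] by (simp add: sum_3 \<Gamma>' has_field_derivative_at_within)
  qed
  have rot1: "rotation_speed A g nabla I \<gamma> (\<lambda>s. E 1 (\<gamma> s)) (\<lambda>s. E 3 (\<gamma> s)) t
      = \<epsilon> * (vel_comp \<gamma> t $ 3 * (k - c / 2))"
    if "arc_length_geodesic A g nabla I \<gamma>" "t \<in> I" for I \<gamma> t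
    using rotation_speed_about_axis[OF geodesicD(1)[OF that(1)] that(2) velocity_eq_vel_comp[OF geodesicD(1)[OF that(1)] that(2)]]
    by (simp add: sum_3 \<Gamma>')
  have rot3: "rotation_speed A g nabla I \<gamma> (\<lambda>s. E 3 (\<gamma> s)) (velocity A \<gamma>) t
      = \<epsilon> * (c / 2 * (1 - (vel_comp \<gamma> t $ 3)\<^sup>2))"
    if "arc_length_geodesic A g nabla I \<gamma>" "t \<in> I" for I \<gamma> t
  proof -
    \<comment> \<open>The rotation speed comes out as a multiple of the squared length of the part
      orthogonal to \<open>E 3\<close>; unit speed turns this into a function of the third
      component.\<close>
    have n: "1 - (vel_comp \<gamma> t $ 3)\<^sup>2 = (vel_comp \<gamma> t $ 1)\<^sup>2 + (vel_comp \<gamma> t $ 2)\<^sup>2"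
      using geodesicD(4)[OF that] by (simp add: inner_vec_def sum_3 power2_eq_square)
    show ?thesis
      unfolding n using rotation_speed_axis[OF geodesicD(1)[OF that(1)] that(2) velocity_eq_vel_comp[OF geodesicD(1)[OF that(1)] that(2)]]
      by (simp add: sum_3 \<Gamma>' power2_eq_square algebra_simps add_divide_distrib)
  qed
  show ?thesis
    unfolding determines_top_def constant_on_def
  proof (intro conjI allI impI ballI)
    fix I \<gamma> assume geo: "arc_length_geodesic A g nabla I \<gamma>"
    obtain z where "\<forall>t\<in>I. vel_comp \<gamma> t $ 3 = z" using const[OF geo] by blast
    then show "\<exists>y. \<forall>x\<in>I. angle g (\<gamma> x) (velocity A \<gamma> x) (E 3 (\<gamma> x)) = y"
      using geodesicD(7)[OF geo] by auto
  next
    fix I \<gamma> assume h: "arc_length_geodesic A g nabla I \<gamma> \<and>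
        (\<forall>t\<in>I. velocity A \<gamma> t \<notin> axis_bundle A (\<lambda>p. g p (E 1 p)) (\<lambda>p. g p (E 2 p)) (\<gamma> t))"
    from h have geo: "arc_length_geodesic A g nabla I \<gamma>" by (rule conjunct1)
    obtain z where z: "\<forall>t\<in>I. vel_comp \<gamma> t $ 3 = z" using const[OF geo] by blast
    have "rotation_speed A g nabla I \<gamma> (\<lambda>t. E 3 (\<gamma> t)) (velocity A \<gamma>) t = \<epsilon> * (c / 2 * (1 - z\<^sup>2))"
      if "t \<in> I" for t
      using rot3[OF geo that] z that by simp
    then show "\<exists>y. \<forall>x\<in>I. rotation_speed A g nabla I \<gamma> (\<lambda>t. E 3 (\<gamma> t)) (velocity A \<gamma>) x = y"
      by blast
  next
    fix I \<gamma> assume geo: "arc_length_geodesic A g nabla I \<gamma>"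
    obtain z where z: "\<forall>t\<in>I. vel_comp \<gamma> t $ 3 = z" using const[OF geo] by blast
    have "rotation_speed A g nabla I \<gamma> (\<lambda>t. E 1 (\<gamma> t)) (\<lambda>t. E 3 (\<gamma> t)) t = \<epsilon> * (z * (k - c / 2))"
      if "t \<in> I" for t
      using rot1[OF geo that] z that by simp
    then show "\<exists>y. \<forall>x\<in>I. rotation_speed A g nabla I \<gamma> (\<lambda>t. E 1 (\<gamma> t)) (\<lambda>t. E 3 (\<gamma> t)) x = y"
      by blast
  next
    fix I \<gamma> J \<delta> t s
    assume h: "arc_length_geodesic A g nabla I \<gamma> \<and> arc_length_geodesic A g nabla J \<delta> \<and>
        (\<forall>t\<in>I. \<forall>s\<in>J. angle g (\<gamma> t) (velocity A \<gamma> t) (E 3 (\<gamma> t)) =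
                      angle g (\<delta> s) (velocity A \<delta> s) (E 3 (\<delta> s)))"
      and ts: "t \<in> I" "s \<in> J"
    then have geo: "arc_length_geodesic A g nabla I \<gamma>" "arc_length_geodesic A g nabla J \<delta>" by auto
    have "arccos (vel_comp \<gamma> t $ 3) = arccos (vel_comp \<delta> s $ 3)"
      using h ts geodesicD(7)[OF geo(1) ts(1)] geodesicD(7)[OF geo(2) ts(2)] by simp
    \<comment> \<open>arccos is injective on the interval from -1 to 1, where both components
      lie.\<close>
    then have "vel_comp \<gamma> t $ 3 = vel_comp \<delta> s $ 3"
      using arccos_eq_iff[of "vel_comp \<gamma> t $ 3" "vel_comp \<delta> s $ 3"]
        geodesicD(5)[OF geo(1) ts(1)] geodesicD(5)[OF geo(2) ts(2)] by blast
    then show "rotation_speed A g nabla I \<gamma> (\<lambda>t. E 1 (\<gamma> t)) (\<lambda>t. E 3 (\<gamma> t)) t =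
        rotation_speed A g nabla J \<delta> (\<lambda>s. E 1 (\<delta> s)) (\<lambda>s. E 3 (\<delta> s)) s"
      using rot1[OF geo(1) ts(1)] rot1[OF geo(2) ts(2)] by simp
  qed
qed

lemma top_imp_lie_brackets:
  assumes top: "determines_top A g nabla (E 1) (E 2) (E 3)"
  shows "\<exists>c k. lie_bracket A (E 1) (E 2) = (\<lambda>p f. c * E 3 p f) \<and>
    lie_bracket A (E 2) (E 3) = (\<lambda>p f. k * E 1 p f) \<and>
    lie_bracket A (E 3) (E 1) = (\<lambda>p f. k * E 2 p f)"
proof -
  have const: "(\<lambda>t. vel_comp \<gamma> t $ 3) constant_on I" if geo: "arc_length_geodesic A g nabla I \<gamma>" for I \<gamma>
  proof -
    have "(\<lambda>t. angle g (\<gamma> t) (velocity A \<gamma> t) (E 3 (\<gamma> t))) constant_on I"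
      using top[unfolded determines_top_def, THEN conjunct1] geo by blast
    then obtain y where "\<And>t. t \<in> I \<Longrightarrow> arccos (vel_comp \<gamma> t $ 3) = y"
      unfolding constant_on_def using geodesicD(7)[OF geo] by metis
    then have "vel_comp \<gamma> t $ 3 = cos y" if "t \<in> I" for t
      using cos_arccos_abs[OF geodesicD(5)[OF geo that]] that by metis
    then show ?thesis unfolding constant_on_def by blast
  qed
  \<comment> \<open>The derivative at time 0 of the constant third component is minus this quadratic
    form, evaluated at the initial direction \<open>w\<close>.\<close>
  have quad: "(\<Sum>j\<in>UNIV. \<Sum>i\<in>UNIV. w $ j * w $ i * \<Gamma> i j 3 p) = 0" if w: "w \<bullet> w = 1" for w p
  proof -
    obtain I \<gamma> where geo: "arc_length_geodesic A g nabla I \<gamma>" "0 \<in> I" "\<gamma> 0 = p"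
      "velocity A \<gamma> 0 = frame_vec p w" using geodesic_exists[OF w] by metis
    have "vel_comp \<gamma> 0 = w" using geo by (simp add: vel_comp_def)
    then show ?thesis
      using constant_on_imp_deriv_zero[OF const[OF geo(1)] geodesicD(2)[OF geo(1)] geo(2)]
        DERIV_imp_deriv[OF geodesicD(6)[OF geo(1,2), of 3]] geo(3) by simp
  qed
  have unit: "vector [x, y, z] \<bullet> (vector [x, y, z] :: real^3) = 1" if "x * x + y * y + z * z = 1" for x y z :: real
    using that by (simp add: inner_vec_def sum_3)
  have \<Gamma>3: "\<Gamma> 1 1 3 p = 0" "\<Gamma> 2 2 3 p = 0" "\<Gamma> 3 1 3 p = 0" "\<Gamma> 3 2 3 p = 0" "\<Gamma> 2 1 3 p = - \<Gamma> 1 2 3 p" for p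
  proof -
    show 1: "\<Gamma> 1 1 3 p = 0" using quad[OF unit[of 1 0 0], of p] by (simp add: sum_3)
    show 2: "\<Gamma> 2 2 3 p = 0" using quad[OF unit[of 0 1 0], of p] by (simp add: sum_3)
    \<comment> \<open>The Pythagorean triple 3, 4, 5 supplies rational unit vectors with two nonzero
      entries. Since the diagonal terms are already 0, they isolate the mixed terms of the quadratic
      form.\<close>
    show "\<Gamma> 3 1 3 p = 0" using quad[OF unit[of "3/5" 0 "4/5"], of p] 1 by (simp add: sum_3)
    show "\<Gamma> 3 2 3 p = 0" using quad[OF unit[of 0 "3/5" "4/5"], of p] 2 by (simp add: sum_3)
    show "\<Gamma> 2 1 3 p = - \<Gamma> 1 2 3 p" using quad[OF unit[of "3/5" "4/5" 0], of p] 1 2 by (simp add: sum_3)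
  qed
  note \<Gamma>3' = \<Gamma>3 \<Gamma>_antisym[of _ 3 1] \<Gamma>_antisym[of _ 3 2]
  define \<mu> where "\<mu> = \<Gamma> 1 2 3"
  \<comment> \<open>The condition on \<open>w $ 3\<close> says that the unit vector \<open>w\<close>
    is transverse to the axis. Along the geodesic with this initial velocity the rotation speed is
    \<mu> times a nonzero constant, so by (ii) \<mu> is constant along it.\<close>
  have \<mu>0: "frame_vec p w \<mu> = 0" if w: "w \<bullet> w = 1" "(w $ 3)\<^sup>2 \<noteq> 1" for w p
  proof -
    obtain I \<gamma> where geo: "arc_length_geodesic A g nabla I \<gamma>" "0 \<in> I" "\<gamma> 0 = p"
      "velocity A \<gamma> 0 = frame_vec p w" using geodesic_exists[OF w(1)] by metis
    note \<gamma> = geodesicD(1)[OF geo(1)]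
    note v = velocity_eq_vel_comp[OF \<gamma>]
    have "vel_comp \<gamma> 0 = w" using geo by (simp add: vel_comp_def)
    then have w3: "vel_comp \<gamma> t $ 3 = w $ 3" if "t \<in> I" for t
      using const[OF geo(1)] geo(2) that unfolding constant_on_def by metis
    have n: "(vel_comp \<gamma> t $ 1)\<^sup>2 + (vel_comp \<gamma> t $ 2)\<^sup>2 = 1 - (w $ 3)\<^sup>2" if "t \<in> I" for t
      using geodesicD(4)[OF geo(1) that] w3[OF that] by (simp add: inner_vec_def sum_3 power2_eq_square)
    \<comment> \<open>The squared length of the part orthogonal to \<open>E 3\<close> keeps its
      initial nonzero value, so transversality holds on all of \<open>I\<close>.\<close>
    have "velocity A \<gamma> t \<notin> axis_bundle A (\<lambda>p. g p (E 1 p)) (\<lambda>p. g p (E 2 p)) (\<gamma> t)" if "t \<in> I" for t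
      using velocity_in_axis_bundle_iff[OF \<gamma> that v[OF that]] n[OF that] w(2) by auto
    then have "rotation_speed A g nabla I \<gamma> (\<lambda>t. E 3 (\<gamma> t)) (velocity A \<gamma>) constant_on I"
      using top[unfolded determines_top_def, THEN conjunct2, THEN conjunct1] geo(1) by blast
    then obtain y where y: "\<And>t. t \<in> I \<Longrightarrow> rotation_speed A g nabla I \<gamma> (\<lambda>t. E 3 (\<gamma> t)) (velocity A \<gamma>) t = y"
      unfolding constant_on_def by blast
    have rot3: "rotation_speed A g nabla I \<gamma> (\<lambda>t. E 3 (\<gamma> t)) (velocity A \<gamma>) t
        = \<epsilon> * (\<mu> (\<gamma> t) * (1 - (w $ 3)\<^sup>2))" if "t \<in> I" for t
      unfolding n[OF that, symmetric]
      using rotation_speed_axis[OF \<gamma> that v[OF that]]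
      by (simp add: sum_3 \<Gamma>3' \<mu>_def power2_eq_square algebra_simps)
    have "\<epsilon> \<noteq> 0" "1 - (w $ 3)\<^sup>2 \<noteq> 0" using \<epsilon>(1) w(2) by auto
    then have "\<mu> (\<gamma> t) = y / (\<epsilon> * (1 - (w $ 3)\<^sup>2))" if "t \<in> I" for t
      using rot3[OF that] y[OF that] by (simp add: field_simps)
    then have "(\<lambda>t. \<mu> (\<gamma> t)) constant_on I" unfolding constant_on_def by blast
    from constant_on_imp_deriv_zero[OF this geodesicD(2)[OF geo(1)] geo(2)]
    show ?thesis
      using velocity_apply(2)[OF \<gamma> geo(2) open_UNIV _ \<Gamma>_smooth[of 1 2 3]] geo(3,4) by (simp add: \<mu>_def)
  qed
  have "v \<mu> = 0" if "v \<in> tangent_space A p" for v p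
  proof -
    have "E 1 p \<mu> = 0" using \<mu>0[OF unit[of 1 0 0], of p] by (simp add: frame_vec_def sum_3)
    moreover have "E 2 p \<mu> = 0" using \<mu>0[OF unit[of 0 1 0], of p] by (simp add: frame_vec_def sum_3)
    \<comment> \<open>The direction \<open>E 3\<close> is not transverse itself; it is obtained from
      the transverse direction with components 3/5, 0, 4/5 by subtracting the part along
      \<open>E 1\<close>, which already annihilates \<mu>.\<close>
    moreover have "E 3 p \<mu> = 0"
      using \<mu>0[OF unit[of "3/5" 0 "4/5"], of p] \<open>E 1 p \<mu> = 0\<close>
      by (simp add: frame_vec_def sum_3 power2_eq_square)
    ultimately have "frame_vec p w \<mu> = 0" for w by (simp add: frame_vec_def sum_3)
    then show ?thesis using tangent_eq_frame_vec[OF that] by metis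
  qed
  then have \<mu>_const: "\<Gamma> 1 2 3 p = \<Gamma> 1 2 3 q" for p q
    using locally_constant_imp_constant[OF connected \<Gamma>_smooth[of 1 2 3]] unfolding \<mu>_def by blast
  \<comment> \<open>Equal third components of the initial velocities give equal angles at all
    parameters, because these components are constant. Condition (iv) then compares the rotation
    speeds at time 0, at two points that may differ.\<close>
  have lin: "(\<Sum>i\<in>UNIV. u $ i * \<Gamma> i 1 2 p) = (\<Sum>i\<in>UNIV. w $ i * \<Gamma> i 1 2 q)"
    if u: "u \<bullet> u = 1" and w: "w \<bullet> w = 1" and uw: "u $ 3 = w $ 3" for u w p q
  proof -
    obtain I \<gamma> where geo: "arc_length_geodesic A g nabla I \<gamma>" "0 \<in> I" "\<gamma> 0 = p"
      "velocity A \<gamma> 0 = frame_vec p u" using geodesic_exists[OF u] by metis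
    obtain J \<delta> where geo': "arc_length_geodesic A g nabla J \<delta>" "0 \<in> J" "\<delta> 0 = q"
      "velocity A \<delta> 0 = frame_vec q w" using geodesic_exists[OF w] by metis
    have "vel_comp \<gamma> t $ 3 = u $ 3" if "t \<in> I" for t
      using const[OF geo(1)] geo(2-4) that unfolding constant_on_def by (metis vel_comp_def frame_comp_vec)
    moreover have "vel_comp \<delta> t $ 3 = w $ 3" if "t \<in> J" for t
      using const[OF geo'(1)] geo'(2-4) that unfolding constant_on_def by (metis vel_comp_def frame_comp_vec)
    ultimately have "\<forall>t\<in>I. \<forall>s\<in>J. angle g (\<gamma> t) (velocity A \<gamma> t) (E 3 (\<gamma> t)) =
        angle g (\<delta> s) (velocity A \<delta> s) (E 3 (\<delta> s))"
      using geodesicD(7)[OF geo(1)] geodesicD(7)[OF geo'(1)] uw by simp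
    then have "rotation_speed A g nabla I \<gamma> (\<lambda>t. E 1 (\<gamma> t)) (\<lambda>t. E 3 (\<gamma> t)) 0 =
        rotation_speed A g nabla J \<delta> (\<lambda>s. E 1 (\<delta> s)) (\<lambda>s. E 3 (\<delta> s)) 0"
      using top[unfolded determines_top_def, THEN conjunct2, THEN conjunct2, THEN conjunct2]
        geo(1,2) geo'(1,2) by blast
    moreover have "rotation_speed A g nabla I \<gamma> (\<lambda>t. E 1 (\<gamma> t)) (\<lambda>t. E 3 (\<gamma> t)) 0
        = \<epsilon> * (\<Sum>i\<in>UNIV. u $ i * \<Gamma> i 1 2 p)"
      using rotation_speed_about_axis[OF geodesicD(1)[OF geo(1)] geo(2)] geo(3,4) by simp
    moreover have "rotation_speed A g nabla J \<delta> (\<lambda>t. E 1 (\<delta> t)) (\<lambda>t. E 3 (\<delta> t)) 0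
        = \<epsilon> * (\<Sum>i\<in>UNIV. w $ i * \<Gamma> i 1 2 q)"
      using rotation_speed_about_axis[OF geodesicD(1)[OF geo'(1)] geo'(2)] geo'(3,4) by simp
    moreover have "\<epsilon> \<noteq> 0" using \<epsilon>(1) by auto
    ultimately show ?thesis by simp
  qed
  \<comment> \<open>Opposite vectors orthogonal to \<open>E 3\<close> make the same angle with it
    but give the linear expression opposite signs.\<close>
  have "\<Gamma> 1 1 2 p = 0" for p
    using lin[OF unit[of 1 0 0] unit[of "-1" 0 0], of p p] by (simp add: sum_3)
  moreover have "\<Gamma> 2 1 2 p = 0" for p
    using lin[OF unit[of 0 1 0] unit[of 0 "-1" 0], of p p] by (simp add: sum_3)
  moreover have "\<Gamma> 3 1 2 p = \<Gamma> 3 1 2 q" for p q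
    using lin[OF unit[of 0 0 1] unit[of 0 0 1], of p q] by (simp add: sum_3)
  \<comment> \<open>Any point can serve as base point, types being nonempty. The constants are the
    values there, written in the shape required by \<open>lie_brackets_iff\<close> with
    \<open>c = 2 * \<Gamma> 1 2 3 p0\<close> and
    \<open>k = \<Gamma> 3 1 2 p0 + \<Gamma> 1 2 3 p0\<close>.\<close>
  moreover obtain p0 :: 'a where True by blast
  ultimately have "\<forall>p. \<Gamma> 1 1 2 p = 0 \<and> \<Gamma> 2 1 2 p = 0 \<and> \<Gamma> 1 1 3 p = 0 \<and> \<Gamma> 2 2 3 p = 0 \<and> \<Gamma> 3 1 3 p = 0 \<and>
        \<Gamma> 3 2 3 p = 0 \<and> \<Gamma> 1 2 3 p = (2 * \<Gamma> 1 2 3 p0) / 2 \<and> \<Gamma> 2 1 3 p = - (2 * \<Gamma> 1 2 3 p0) / 2 \<and>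
        \<Gamma> 3 1 2 p = (\<Gamma> 3 1 2 p0 + \<Gamma> 1 2 3 p0) - (2 * \<Gamma> 1 2 3 p0) / 2"
    using \<Gamma>3 \<mu>_const[of _ p0] by simp
  then show ?thesis unfolding lie_brackets_iff[symmetric] by blast
qed

end

theorem theorem6:
  fixes A :: "'a::{t2_space, second_countable_topology} chart set"
    and g :: "'a metric"
    and nabla :: "'a connection"
    and X\<^sub>1 X\<^sub>2 X\<^sub>3 :: "'a \<Rightarrow> 'a tangent"
  assumes "connected (UNIV :: 'a set)"
    and "oriented_smooth_atlas A"
    and "riemannian_metric A g"
    and "levi_civita A g nabla"
    and "orthonormal_frame A g X\<^sub>1 X\<^sub>2 X\<^sub>3"
  shows "determines_top A g nabla X\<^sub>1 X\<^sub>2 X\<^sub>3 \<longleftrightarrow>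
    (\<exists>c k :: real.
       lie_bracket A X\<^sub>1 X\<^sub>2 = (\<lambda>p f. c * X\<^sub>3 p f) \<and>
       lie_bracket A X\<^sub>2 X\<^sub>3 = (\<lambda>p f. k * X\<^sub>1 p f) \<and>
       lie_bracket A X\<^sub>3 X\<^sub>1 = (\<lambda>p f. k * X\<^sub>2 p f))"
proof -
  \<comment> \<open>Indexing the three fields by the type \<open>3\<close> makes sums over the frame
    and components in \<open>real^3\<close> available.\<close>
  define E :: "3 \<Rightarrow> 'a \<Rightarrow> 'a tangent" where
    "E = (\<lambda>i. if i = 1 then X\<^sub>1 else if i = 2 then X\<^sub>2 else X\<^sub>3)"
  have E: "E 1 = X\<^sub>1" "E 2 = X\<^sub>2" "E 3 = X\<^sub>3" by (simp_all add: E_def)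
  have X: "smooth_vector_field A UNIV X\<^sub>1" "smooth_vector_field A UNIV X\<^sub>2" "smooth_vector_field A UNIV X\<^sub>3"
    "\<And>p. g p (X\<^sub>1 p) (X\<^sub>1 p) = 1" "\<And>p. g p (X\<^sub>2 p) (X\<^sub>2 p) = 1" "\<And>p. g p (X\<^sub>3 p) (X\<^sub>3 p) = 1"
    "\<And>p. g p (X\<^sub>1 p) (X\<^sub>2 p) = 0" "\<And>p. g p (X\<^sub>1 p) (X\<^sub>3 p) = 0" "\<And>p. g p (X\<^sub>2 p) (X\<^sub>3 p) = 0"
    using assms(5) unfolding orthonormal_frame_def by auto
  have sym: "g p (X p) (Y p) = g p (Y p) (X p)"
    if "smooth_vector_field A UNIV X" "smooth_vector_field A UNIV Y" for X Y p
  proof -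
    have "X p \<in> tangent_space A p" "Y p \<in> tangent_space A p"
      using that unfolding smooth_vector_field_def by blast+
    then show ?thesis
      using assms(3)[unfolded riemannian_metric_def, THEN conjunct2, THEN conjunct1] by blast
  qed
  have on: "\<forall>i j. g p (E i p) (E j p) = (if i = j then 1 else 0)" for p
    unfolding forall_3 E
    by (simp add: X sym[OF X(2,1)] sym[OF X(3,1)] sym[OF X(3,2)])
  have sm: "\<forall>i. smooth_vector_field A UNIV (E i)"
    unfolding forall_3 E using X by blast
  interpret oriented_framed_manifold A g nabla E
    by unfold_locales (use assms(1-4) on sm in \<open>simp_all add: oriented_smooth_atlas_def\<close>)
  show ?thesis
    using top_imp_lie_brackets lie_brackets_imp_top unfolding E by blast
qed

end
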